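(* For $\mathbf{X},\mathbf{U},\mathbf{S},\mathbf{Z}\in\mathbb{R}^6$ and $i\ge2$, the second directional derivatives of $\mathbf{P}_i$ can be expressed as $$(\mathrm{D}_{\mathbf{X}}^2\mathbf{P}_i)(\mathbf{U})(\mathbf{S})\mathbf{Z}=\sum_{j=1}^{i-1}\sum_{l=0}^{j-1}\Big(\mathbf{P}_{j,l}\big(\mathbf{X},\mathbf{ad}_{\mathbf{U}}\mathbf{P}_{i-j-1}(\mathbf{X})\mathbf{Z}\big)\mathbf{S}+\mathbf{P}_{i-j-1}(\mathbf{X})\,\mathbf{ad}_{\mathbf{U}}\,\mathbf{P}_{j,l}(\mathbf{X},\mathbf{Z})\mathbf{S}\Big).$$ The Hessians $\mathbf{H}$ of $h(\mathbf{X}):=\mathbf{Q}^T\mathbf{dexp}_{\mathbf{X}}\mathbf{Z}$ and $\mathbf{H}^{\mathrm{inv}}$ of $h^{\mathrm{inv}}(\mathbf{X}):=\mathbf{Q}^T\mathbf{dexp}_{\mathbf{X}}^{-1}\mathbf{Z}$, parameterized by fixed $\mathbf{Q},\mathbf{Z}\in\mathbb{R}^6$, are $$\mathbf{H}(\mathbf{X})=\sum_{i=2}^\infty\frac1{(i+1)!}\mathbf{H}_i(\mathbf{X}),\qquad \mathbf{H}^{\mathrm{inv}}(\mathbf{X})=\sum_{i=2}^\infty\frac{B_i}{i!}\mathbf{H}_i(\mathbf{X}),$$ where the Hessian $\mathbf{H}_i(\mathbf{X})$ of $\mathbf{Q}^T\mathbf{P}_i(\mathbf{X})\mathbf{Z}$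 is decomposed as $\mathbf{H}_i(\mathbf{X})=\overline{\mathbf{H}}_i(\mathbf{X})+\overline{\mathbf{H}}_i^T(\mathbf{X})$ with, for $i\ge2$, $$\overline{\mathbf{H}}_i(\mathbf{X})=\sum_{j=1}^{i-1}\sum_{l=0}^{j-1}\overline{\mathbf{ad}}_{\overline{\mathbf{Q}}_{i-j-1}}\mathbf{P}_l(\mathbf{X})\,\mathbf{ad}_{\mathbf{Z}_{j-l-1}}=-\sum_{j=1}^{i-1}\sum_{l=0}^{j-1}\overline{\mathbf{ad}}_{\overline{\mathbf{Q}}_{i-j-1}}\mathbf{P}_{j,l}(\mathbf{X},\mathbf{Z}).$$
   Context: For $\mathbf{x}\in\mathbb{R}^3$, $\tilde{\mathbf{x}}$ is the skew-symmetric matrix with $\tilde{\mathbf{x}}\mathbf{w}=\mathbf{x}\times\mathbf{w}$. For $\mathbf{X}=(\mathbf{x},\mathbf{y})\in\mathbb{R}^3\times\mathbb{R}^3\cong se(3)$, $\mathbf{ad}_{\mathbf{X}}=\begin{bmatrix}\tilde{\mathbf{x}}&\mathbf{0}\\ \tilde{\mathbf{y}}&\tilde{\mathbf{x}}\end{bmatrix}$ and $\mathbf{P}_i(\mathbf{X}):=\mathbf{ad}_{\mathbf{X}}^i$ ($\mathbf{P}_0=\mathbf{I}$); for $\mathbf{U}=(\mathbf{u},\mathbf{v})$, $\overline{\mathbf{ad}}_{\mathbf{U}}:=\begin{bmatrix}\tilde{\mathbf{u}}&\tilde{\mathbf{v}}\\ \tilde{\mathbf{v}}&\mathbf{0}\end{bmatrix}$,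 so that $\mathbf{ad}_{\mathbf{X}}^T\mathbf{U}=\overline{\mathbf{ad}}_{\mathbf{U}}\mathbf{X}$. Write $\mathbf{Z}_i:=\mathbf{P}_i(\mathbf{X})\mathbf{Z}$, $\overline{\mathbf{Q}}_i:=\mathbf{P}_i(\mathbf{X})^T\mathbf{Q}$, and for any $\mathbf{W}\in\mathbb{R}^6$ and $0\le j\le i-1$, $\mathbf{P}_{i,j}(\mathbf{X},\mathbf{W}):=-\mathbf{P}_j(\mathbf{X})\,\mathbf{ad}_{\mathbf{P}_{i-j-1}(\mathbf{X})\mathbf{W}}$. For a function $F$ of $\mathbf{X}$: $(\mathrm{D}_{\mathbf{X}}F)(\mathbf{U}):=\frac{d}{dt}F(\mathbf{X}+t\mathbf{U})|_{t=0}$, $(\mathrm{D}_{\mathbf{X}}^2F)(\mathbf{U})(\mathbf{S}):=\frac{d}{dt}(\mathrm{D}_{\mathbf{X}+t\mathbf{S}}F)(\mathbf{U})|_{t=0}$; the Hessian of a scalar function $h$ is $\left[\frac{\partial^2h}{\partial X_i\partial X_j}\right]\in\mathbb{R}^{6\times6}$. The $6\times 6$ matrix $\mathbf{dexp}_{\mathbf{X}}$ of the right-trivialized differential of $\exp$ on $SE(3)$ and its inverse admit the series expansions $\mathbf{dexp}_{\mathbf{X}}=\sum_{i=0}^\infty\frac1{(i+1)!}\mathbf{ad}_{\mathbf{X}}^i$ and $\mathbf{dexp}_{\mathbf{X}}^{-1}=\sum_{i=0}^\infty\frac{B_i}{i!}\mathbf{ad}_{\mathbf{X}}^i$, where $B_i$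 are the Bernoulli numbers with $B_0=1$, $B_1=-\frac12$, $B_2=\frac16$.
   Formalization: The formula for H^inv is stated only for X = (x, y) with |x| < 2π: at |x| = 2π dexp_X is singular, and for |x| > 2π the series with coefficients B_i/i! diverges for general Q, Z. *)

theory Defs
  imports "HOL-Analysis.Analysis"
begin

text \<open>
  Vectors of \<open>\<real>\<^sup>6\<close>, identified with \<open>\<real>\<^sup>3 \<times> \<real>\<^sup>3\<close> and \<open>se(3)\<close>, are indexed by the six-element type
  \<open>3 + 3\<close>: the summand \<open>Inl\<close> carries the angular part \<open>x\<close> and \<open>Inr\<close> the linear part \<open>y\<close> of
  \<open>X = (x, y)\<close>. Homogeneous \<open>4 \<times> 4\<close> matrices are likewise indexed by \<open>3 + 1\<close>.
\<close>

type_synonym vec6 = "real ^ (3 + 3)"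
type_synonym mat6 = "real ^ (3 + 3) ^ (3 + 3)"
type_synonym mat4 = "real ^ (3 + 1) ^ (3 + 1)"

definition ang :: "vec6 \<Rightarrow> real ^ 3" where
  "ang X = (\<chi> a. X $ Inl a)"

definition lin :: "vec6 \<Rightarrow> real ^ 3" where
  "lin X = (\<chi> a. X $ Inr a)"

definition block_mat ::
  "real ^ 'c ^ 'a \<Rightarrow> real ^ 'd ^ 'a \<Rightarrow> real ^ 'c ^ 'b \<Rightarrow> real ^ 'd ^ 'b \<Rightarrow>
   real ^ ('c::finite + 'd::finite) ^ ('a::finite + 'b::finite)" where
  "block_mat A B C D = (\<chi> i j.
     case i of
       Inl a \<Rightarrow> (case j of Inl c \<Rightarrow> A $ a $ c | Inr d \<Rightarrow> B $ a $ d)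
     | Inr b \<Rightarrow> (case j of Inl c \<Rightarrow> C $ b $ c | Inr d \<Rightarrow> D $ b $ d))"

definition skew :: "real ^ 3 \<Rightarrow> real ^ 3 ^ 3" where
  "skew x = matrix (cross3 x)"

lemma skew_mult_vec: "skew x *v w = cross3 x w"
  unfolding skew_def
  using bilinear_cross by (simp add: bilinear_def matrix_works linear_matrix_vector_mul_eq)

definition ad :: "vec6 \<Rightarrow> mat6" where
  "ad X = block_mat (skew (ang X)) 0 (skew (lin X)) (skew (ang X))"

definition ad_bar :: "vec6 \<Rightarrow> mat6" where
  "ad_bar U = block_mat (skew (ang U)) (skew (lin U)) (skew (lin U)) 0"

lemma ad_transpose_mult_vec: "transpose (ad X) *v U = ad_bar U *v X"
proof -
  have sum_split: "(\<Sum>k\<in>UNIV. f k) = (\<Sum>a\<in>UNIV. f (Inl a)) + (\<Sum>a\<in>UNIV. f (Inr a))"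
    for f :: "3 + 3 \<Rightarrow> real"
    by (simp add: UNIV_Plus_UNIV[symmetric] sum.Plus del: UNIV_Plus_UNIV)
  have skew_entries:
    "skew v $ 1 $ 1 = 0" "skew v $ 1 $ 2 = - v $ 3" "skew v $ 1 $ 3 = v $ 2"
    "skew v $ 2 $ 1 = v $ 3" "skew v $ 2 $ 2 = 0" "skew v $ 2 $ 3 = - v $ 1"
    "skew v $ 3 $ 1 = - v $ 2" "skew v $ 3 $ 2 = v $ 1" "skew v $ 3 $ 3 = 0" for v
    by (simp_all add: skew_def matrix_def cross3_def axis_def)
  show ?thesis
    by (simp add: vec_eq_iff split_sum_all forall_3 matrix_vector_mult_def transpose_def ad_def
        ad_bar_def block_mat_def sum_split sum_3 skew_entries ang_def lin_def)
qed

text \<open>The operation \<open>^\<close> on \<^typ>\<open>real ^ 'n ^ 'n\<close> would be componentwise.\<close>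

primrec matpow :: "real ^ 'n::finite ^ 'n \<Rightarrow> nat \<Rightarrow> real ^ 'n ^ 'n" where
  "matpow A 0 = mat 1"
| "matpow A (Suc n) = A ** matpow A n"

definition P :: "nat \<Rightarrow> vec6 \<Rightarrow> mat6" where
  "P i X = matpow (ad X) i"

text \<open>Only meant for \<open>j < i\<close>.\<close>

definition P2 :: "nat \<Rightarrow> nat \<Rightarrow> vec6 \<Rightarrow> vec6 \<Rightarrow> mat6" where
  "P2 i j X W = - (P j X ** ad (P (i - j - 1) X *v W))"

definition D1 :: "('a::real_normed_vector \<Rightarrow> 'b::real_normed_vector) \<Rightarrow> 'a \<Rightarrow> 'a \<Rightarrow> 'b" where
  "D1 F X U = vector_derivative (\<lambda>t. F (X + t *\<^sub>R U)) (at 0)"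

definition D2 :: "('a::real_normed_vector \<Rightarrow> 'b::real_normed_vector) \<Rightarrow> 'a \<Rightarrow> 'a \<Rightarrow> 'a \<Rightarrow> 'b" where
  "D2 F X U S = vector_derivative (\<lambda>t. D1 F (X + t *\<^sub>R S) U) (at 0)"

text \<open>
  \<^const>\<open>vector_derivative\<close> is total, so the existence of the derivatives in \<^const>\<open>D2\<close> is
  expressed separately.
\<close>

definition D2_exists ::
  "('a::real_normed_vector \<Rightarrow> 'b::real_normed_vector) \<Rightarrow> 'a \<Rightarrow> 'a \<Rightarrow> 'a \<Rightarrow> bool" where
  "D2_exists F X U S \<longleftrightarrow>
     (\<forall>\<^sub>F t in nhds 0. (\<lambda>s. F (X + t *\<^sub>R S + s *\<^sub>R U)) differentiable (at 0)) \<and>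
     (\<lambda>t. D1 F (X + t *\<^sub>R S) U) differentiable (at 0)"

definition hessian :: "(real ^ 'n::finite \<Rightarrow> real) \<Rightarrow> real ^ 'n \<Rightarrow> real ^ 'n ^ 'n" where
  "hessian h X = (\<chi> i j. D2 h X (axis j 1) (axis i 1))"

definition hessian_exists :: "(real ^ 'n::finite \<Rightarrow> real) \<Rightarrow> real ^ 'n \<Rightarrow> bool" where
  "hessian_exists h X \<longleftrightarrow> (\<forall>i j. D2_exists h X (axis j 1) (axis i 1))"

text \<open>
  \<open>se3_hat (x, y)\<close> is the homogeneous matrix with rows \<open>(skew x, y)\<close> and \<open>(0, 0)\<close>, so that the
  commutator of \<open>se3_hat X\<close> and \<open>se3_hat U\<close> is \<open>se3_hat (ad X *v U)\<close>. The exponential is the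
  matrix exponential (\<^const>\<open>exp\<close> is not available at matrix type).
\<close>

definition se3_hat :: "vec6 \<Rightarrow> mat4" where
  "se3_hat X = block_mat (skew (ang X)) (\<chi> a b. lin X $ a) 0 0"

definition matexp :: "real ^ 'n::finite ^ 'n \<Rightarrow> real ^ 'n ^ 'n" where
  "matexp A = (\<Sum>n. (1 / fact n) *\<^sub>R matpow A n)"

definition se3_exp :: "vec6 \<Rightarrow> mat4" where
  "se3_exp X = matexp (se3_hat X)"

text \<open>
  The matrix of the right-trivialized differential: the differential of \<open>exp\<close> at \<open>X\<close> maps \<open>U\<close> to
  \<open>se3_hat (dexp X *v U) ** se3_exp X\<close>.
\<close>

definition dexp :: "vec6 \<Rightarrow> mat6" where
  "dexp X = (THE D. (se3_exp has_derivative (\<lambda>U. se3_hat (D *v U) ** se3_exp X)) (at X))"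

text \<open>Bernoulli numbers with the convention that the first one is \<open>- 1 / 2\<close>.\<close>

fun bernoulli :: "nat \<Rightarrow> real" where
  "bernoulli 0 = 1"
| "bernoulli (Suc n) = - (\<Sum>k\<le>n. real ((n + 2) choose k) * bernoulli k) / real (n + 2)"

lemma bernoulli_1_2: "bernoulli 1 = - 1 / 2" "bernoulli 2 = 1 / 6"
  by (simp_all add: numeral_2_eq_2)

definition H_bar :: "nat \<Rightarrow> vec6 \<Rightarrow> vec6 \<Rightarrow> vec6 \<Rightarrow> mat6" where
  "H_bar i Q Z X =
     (\<Sum>j = 1..i - 1. \<Sum>l = 0..j - 1.
        ad_bar (transpose (P (i - j - 1) X) *v Q) ** P l X ** ad (P (j - l - 1) X *v Z))"

end

theory Submission
  imports Defs "HOL-Complex_Analysis.Laurent_Convergence"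
begin

unbundle no fps_syntax

text \<open>
  The powers \<open>P i X\<close> are powers of a matrix that depends linearly on \<open>X\<close>. Hence their first and
  second directional derivatives are sums of words in the letter \<open>ad X\<close> with one letter replaced by
  \<open>ad U\<close>, and then another one by \<open>ad S\<close>. In a word of the second kind \<open>ad U\<close> stands either to the
  left or to the right of \<open>ad S\<close>; the two kinds are exchanged when \<open>U\<close> and \<open>S\<close> are. Writing each
  kind as a sum over the position of \<open>ad U\<close> and moving \<open>S\<close> to the end of the word by the antisymmetry
  of \<open>ad\<close> gives the formula for the second derivative (\<open>D2_P\<close>). Paired with \<open>Q\<close> and
  \<open>Z\<close>, one kind is the bilinear form of \<open>H_bar\<close> and the other its transpose (\<open>inner_H_bar\<close>,
  \<open>hessian_P\<close>).

  The Hessians of \<open>dexp\<close> and its inverse follow by termwise differentiation of power series in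
  \<open>ad X\<close>. The derivatives of the \<open>n\<close>-th power are bounded by \<open>n r\<^bsup>n-1\<^esup>\<close> and \<open>n (n-1) r\<^bsup>n-2\<^esup>\<close> in any
  submultiplicative norm in which the matrix has norm at most \<open>r\<close>, so a matrix power series can be
  differentiated twice whenever the scalar series converges beyond \<open>r\<close>
  (\<open>has_derivative_power_series\<close>, \<open>has_derivative_dpow_series\<close>).

  That \<open>dexp\<close> is such a series must be derived from its definition by the differential of the
  exponential. The derivative of \<open>A\<^sup>n / n!\<close> in direction \<open>B\<close>, rewritten by commutators of \<open>A\<close> with \<open>B\<close>,
  is a term of the Cauchy product of \<open>\<Sum>i. ad\<^sub>A\<^sup>i B / (i + 1)!\<close> and \<open>exp A\<close> (\<open>suminf_dpow_exp\<close>,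
  \<open>dexp_eq_series\<close>). Its inverse is the series with coefficients \<open>B\<^sub>n / n!\<close>, because the
  generating function of the Bernoulli numbers is the reciprocal of \<open>(exp z - 1) / z\<close>. That series has
  radius of convergence at least \<open>2 * pi\<close>, since \<open>exp z - 1\<close> has only the zero \<open>z = 0\<close> in this disc
  (\<open>summable_bernoulli\<close>).

  The convergence condition of the inverse concerns the angular part of \<open>X\<close> alone, while the operator
  norm of \<open>ad X\<close> also depends on the linear part. Scaling the linear part by a small factor
  is a conjugation of \<open>ad X\<close>, and yields a submultiplicative norm in which \<open>ad X\<close> is as close
  to the norm of the angular part as desired (\<open>obtain_norm_ad_less\<close>).
\<close>

section \<open>Matrix products as bounded bilinear maps\<close>

lemma matrix_add_rdistrib: "(A + B) ** C = A ** C + B ** (C :: real ^ 'k ^ 'n)"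
  by (simp add: matrix_matrix_mult_def vec_eq_iff algebra_simps sum.distrib)

lemma bounded_bilinear_matrix_matrix_mult:
  "bounded_bilinear ((**) :: real ^ 'n::finite ^ 'm::finite \<Rightarrow> real ^ 'k::finite ^ 'n \<Rightarrow> real ^ 'k ^ 'm)"
  by (subst bilinear_conv_bounded_bilinear [symmetric])
    (auto simp: bilinear_def linear_iff matrix_add_ldistrib matrix_add_rdistrib
       scalar_matrix_assoc [symmetric] matrix_scalar_ac)

lemma bounded_bilinear_matrix_vector_mult:
  "bounded_bilinear ((*v) :: real ^ 'n::finite ^ 'm::finite \<Rightarrow> real ^ 'n \<Rightarrow> real ^ 'm)"
  by (subst bilinear_conv_bounded_bilinear [symmetric])
    (auto simp: bilinear_def linear_iff matrix_vector_mult_add_rdistrib matrix_vector_right_distrib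
       scaleR_matrix_vector_assoc [symmetric] matrix_vector_mult_scaleR)

interpretation matrix_mult: bounded_bilinear
  "(**) :: real ^ 'n::finite ^ 'm::finite \<Rightarrow> real ^ 'k::finite ^ 'n \<Rightarrow> real ^ 'k ^ 'm"
  by (rule bounded_bilinear_matrix_matrix_mult)

interpretation matrix_vector: bounded_bilinear
  "(*v) :: real ^ 'n::finite ^ 'm::finite \<Rightarrow> real ^ 'n \<Rightarrow> real ^ 'm"
  by (rule bounded_bilinear_matrix_vector_mult)

section \<open>Derivatives of matrix powers\<close>

text \<open>
  \<open>dpow A B n\<close> is the sum of all words of length \<open>n\<close> with one letter \<open>B\<close> and all others \<open>A\<close>, and
  \<open>d2pow A B C n\<close> the sum of those with one letter \<open>B\<close>, one \<open>C\<close> and all others \<open>A\<close>. The recursions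
  split off the first letter, which is the product rule for \<open>A ** matpow A n\<close>; they make the
  derivatives and the norm bounds below immediate inductions.
\<close>

primrec dpow :: "real ^ 'n::finite ^ 'n \<Rightarrow> real ^ 'n ^ 'n \<Rightarrow> nat \<Rightarrow> real ^ 'n ^ 'n" where
  "dpow A B 0 = 0"
| "dpow A B (Suc n) = A ** dpow A B n + B ** matpow A n"

primrec d2pow ::
  "real ^ 'n::finite ^ 'n \<Rightarrow> real ^ 'n ^ 'n \<Rightarrow> real ^ 'n ^ 'n \<Rightarrow> nat \<Rightarrow> real ^ 'n ^ 'n" where
  "d2pow A B C 0 = 0"
| "d2pow A B C (Suc n) = A ** d2pow A B C n + C ** dpow A B n + B ** dpow A C n"

lemma matpow_diff:
  assumes "j < n"
  shows "matpow A (n - j) = A ** matpow A (n - Suc j)"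
  by (metis Suc_diff_Suc [OF assms] matpow.simps(2))

lemma has_derivative_matpow: "((\<lambda>A. matpow A n) has_derivative (\<lambda>B. dpow A B n)) (at A)"
proof (induction n)
  case (Suc n)
  show ?case
    using matrix_mult.FDERIV [OF has_derivative_ident Suc] by simp
qed simp

lemma has_derivative_dpow: "((\<lambda>A. dpow A B n) has_derivative (\<lambda>C. d2pow A B C n)) (at A)"
proof (induction n)
  case (Suc n)
  have "((\<lambda>A. A ** dpow A B n + B ** matpow A n) has_derivative
      (\<lambda>C. (A ** d2pow A B C n + C ** dpow A B n) + B ** dpow A C n)) (at A)"
    by (intro has_derivative_add matrix_mult.FDERIV [OF has_derivative_ident Suc]
         bounded_linear.has_derivative [OF matrix_mult.bounded_linear_right] has_derivative_matpow)
  then show ?case by simp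
qed simp

lemma dpow_eq_sum: "dpow A B n = (\<Sum>l<n. matpow A l ** B ** matpow A (n - Suc l))"
proof (induction n)
  case (Suc n)
  have "(\<Sum>l<Suc n. matpow A l ** B ** matpow A (Suc n - Suc l)) =
      B ** matpow A n + (\<Sum>l<n. matpow A (Suc l) ** B ** matpow A (n - Suc l))"
    by (subst sum.lessThan_Suc_shift) simp
  also have "\<dots> = B ** matpow A n + A ** dpow A B n"
    by (simp add: Suc matrix_mult.sum_right matrix_mul_assoc)
  finally show ?case by (simp add: add.commute)
qed simp

text \<open>
  Prefixing every word by \<open>A\<close> adds one letter and leaves only the words that begin with \<open>B\<close> to be
  added; this is the induction step for sums that are organised by the position of the left one of
  two marked letters.
\<close>

lemma sum_words_shift:
  "(\<Sum>j<Suc n. matpow A (n - j) ** B ** dpow A C j) =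
     B ** dpow A C n + A ** (\<Sum>j<n. matpow A (n - Suc j) ** B ** dpow A C j)"
  by (simp add: matrix_mult.sum_right matrix_mul_assoc matpow_diff [symmetric] add.commute cong: sum.cong_simp)

text \<open>In each word either \<open>B\<close> stands to the left of \<open>C\<close> or \<open>C\<close> to the left of \<open>B\<close>.\<close>
lemma d2pow_eq_sum:
  "d2pow A B C n = (\<Sum>j<n. matpow A (n - Suc j) ** B ** dpow A C j)
     + (\<Sum>j<n. matpow A (n - Suc j) ** C ** dpow A B j)"
proof (induction n)
  case (Suc n)
  have "d2pow A B C (Suc n) =
      (B ** dpow A C n + A ** (\<Sum>j<n. matpow A (n - Suc j) ** B ** dpow A C j)) +
      (C ** dpow A B n + A ** (\<Sum>j<n. matpow A (n - Suc j) ** C ** dpow A B j))"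
    by (simp add: Suc matrix_mult.add_right)
  then show ?case
    by (simp only: sum_words_shift [symmetric] diff_Suc_Suc)
qed simp

text \<open>
  Both sides are the sum of the words in which \<open>C\<close> stands to the left of \<open>B\<close>: on the left the outer
  sum runs over the position of \<open>C\<close>, on the right over that of \<open>B\<close>.
\<close>
lemma sum_words_regroup:
  "(\<Sum>j<n. matpow A (n - Suc j) ** C ** dpow A B j) = (\<Sum>j<n. dpow A C j ** B ** matpow A (n - Suc j))"
proof (induction n)
  case (Suc n)
  have "(\<Sum>j<Suc n. dpow A C j ** B ** matpow A (n - j)) =
      (\<Sum>j<n. dpow A C (Suc j) ** B ** matpow A (n - Suc j))"
    by (simp only: sum.lessThan_Suc_shift) simp
  also have "\<dots> = A ** (\<Sum>j<n. dpow A C j ** B ** matpow A (n - Suc j)) + C ** dpow A B n"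
    by (simp add: matrix_mult.add_left sum.distrib matrix_mult.sum_right matrix_mul_assoc
        dpow_eq_sum [of A B])
  finally show ?case
    by (simp only: sum_words_shift Suc diff_Suc_Suc add.commute)
qed simp

text \<open>
  Here \<open>c i\<close> is the \<open>i\<close>-fold commutator of \<open>A\<close> with \<open>c 0\<close>. Moving all letters \<open>A\<close> to the right of
  the marked letter produces commutators, counted by binomial coefficients: Pascal's rule is the
  induction step.
\<close>

lemma dpow_eq_commutator_sum:
  fixes A :: "real ^ 'n::finite ^ 'n"
  assumes c: "\<And>i. A ** c i = c (Suc i) + c i ** A"
  shows "dpow A (c 0) n = (\<Sum>i<n. real (n choose Suc i) *\<^sub>R (c i ** matpow A (n - Suc i)))"
proof (induction n)
  case (Suc n)
  have step: "A ** (c i ** matpow A (n - Suc i)) = c (Suc i) ** matpow A (n - Suc i) + c i ** matpow A (n - i)"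
    if "i < n" for i
    using that by (simp add: matrix_mul_assoc c matpow_diff matrix_mult.add_left)
  define g where "g i = c i ** matpow A (n - i)" for i
  have "A ** dpow A (c 0) n =
      (\<Sum>i<n. real (n choose Suc i) *\<^sub>R (c (Suc i) ** matpow A (n - Suc i) + c i ** matpow A (n - i)))"
    by (simp add: Suc matrix_mult.sum_right matrix_mult.scaleR_right step)
  also have "\<dots> = (\<Sum>i<n. real (n choose Suc i) *\<^sub>R g (Suc i)) + (\<Sum>i<n. real (n choose Suc i) *\<^sub>R g i)"
    by (simp add: g_def scaleR_add_right sum.distrib)
  also have "(\<Sum>i<n. real (n choose Suc i) *\<^sub>R g i) = (\<Sum>i<Suc n. real (n choose Suc i) *\<^sub>R g i)"
    by simp
  finally have "dpow A (c 0) (Suc n) = ((\<Sum>i<n. real (n choose Suc i) *\<^sub>R g (Suc i)) + g 0)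
      + (\<Sum>i<Suc n. real (n choose Suc i) *\<^sub>R g i)"
    by (simp add: g_def)
  also have "(\<Sum>i<n. real (n choose Suc i) *\<^sub>R g (Suc i)) + g 0 = (\<Sum>i<Suc n. real (n choose i) *\<^sub>R g i)"
    by (subst sum.lessThan_Suc_shift) simp
  also have "(\<Sum>i<Suc n. real (n choose i) *\<^sub>R g i) + (\<Sum>i<Suc n. real (n choose Suc i) *\<^sub>R g i)
      = (\<Sum>i<Suc n. real (Suc n choose Suc i) *\<^sub>R g i)"
    by (simp add: sum.distrib [symmetric] scaleR_add_left [symmetric] del: sum.lessThan_Suc)
  finally show ?case by (simp add: g_def)
qed simp

section \<open>Termwise differentiation of matrix power series\<close>

text \<open>
  The Weierstrass test for Frechet derivatives: on \<open>S\<close> the derivatives are dominated by a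
  summable sequence that does not depend on the point.
\<close>
lemma has_derivative_suminf:
  fixes F :: "nat \<Rightarrow> 'a::real_normed_vector \<Rightarrow> 'b::banach"
  assumes "open S" "convex S" "x \<in> S"
    and F': "\<And>n y. y \<in> S \<Longrightarrow> (F n has_derivative F' n y) (at y)"
    and bound: "\<And>n y h. y \<in> S \<Longrightarrow> norm (F' n y h) \<le> b n * norm h"
    and b: "summable b" "\<And>n. 0 \<le> b n"
    and F: "summable (\<lambda>n. F n x)"
  shows "((\<lambda>y. \<Sum>n. F n y) has_derivative (\<lambda>h. \<Sum>n. F' n x h)) (at x)"
proof -
  have sum_F': "summable (\<lambda>n. F' n y h)" if "y \<in> S" for y h
    by (rule summable_comparison_test' [where g = "\<lambda>n. b n * norm h"])
      (use bound that summable_mult2 [OF b(1)] in auto)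
  have "\<exists>g. \<forall>y\<in>S. (\<lambda>n. F n y) sums g y \<and> (g has_derivative (\<lambda>h. \<Sum>n. F' n y h)) (at y within S)"
  proof (rule has_derivative_series [where x = x and l = "\<Sum>n. F n x"])
    fix e :: real
    assume "e > 0"
    from order_tendstoD(2) [OF suminf_exist_split2 [OF b(1)] this]
    have "\<forall>\<^sub>F n in sequentially. (\<Sum>k. b (k + n)) < e" .
    then show "\<forall>\<^sub>F n in sequentially. \<forall>y\<in>S. \<forall>h.
        norm ((\<Sum>i<n. F' i y h) - (\<Sum>n. F' n y h)) \<le> e * norm h"
    proof eventually_elim
      case (elim n)
      show ?case
      proof (intro ballI allI)
        fix y h
        assume y: "y \<in> S"
        have b_n: "summable (\<lambda>k. b (k + n))" using b(1) by (rule summable_ignore_initial_segment)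
        have "norm ((\<Sum>i<n. F' i y h) - (\<Sum>n. F' n y h)) = norm (\<Sum>k. F' (k + n) y h)"
          using suminf_split_initial_segment [OF sum_F' [OF y], of h n]
          by (simp add: norm_minus_commute)
        also have "\<dots> \<le> (\<Sum>k. b (k + n) * norm h)"
          by (rule norm_suminf_le) (use bound y summable_mult2 [OF b_n] in auto)
        also have "\<dots> = (\<Sum>k. b (k + n)) * norm h"
          by (rule suminf_mult2 [OF b_n, symmetric])
        also have "\<dots> \<le> e * norm h" using elim by (intro mult_right_mono) auto
        finally show "norm ((\<Sum>i<n. F' i y h) - (\<Sum>n. F' n y h)) \<le> e * norm h" .
      qed
    qed
  qed (use assms in \<open>auto intro: has_derivative_at_withinI summable_sums\<close>)
  then obtain g where g: "\<And>y. y \<in> S \<Longrightarrow> (\<lambda>n. F n y) sums g y"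
      "(g has_derivative (\<lambda>h. \<Sum>n. F' n x h)) (at x within S)"
    using \<open>x \<in> S\<close> by blast
  have "(g has_derivative (\<lambda>h. \<Sum>n. F' n x h)) (at x)"
    using g(2) at_within_open [OF \<open>x \<in> S\<close> \<open>open S\<close>] by simp
  then show ?thesis
    by (rule has_derivative_transform_within_open [OF _ \<open>open S\<close> \<open>x \<in> S\<close>]) (auto dest: g(1) sums_unique)
qed

text \<open>
  The norm is a parameter because the condition \<open>N A < R\<close> for the convergence of a power series at
  \<open>A\<close> depends on it: a norm adapted to \<open>A\<close> brings \<open>N A\<close> as close to the spectral radius of \<open>A\<close> as
  desired. The equivalence with the standard norm is what transfers convergence and
  differentiability.
\<close>
locale matrix_algebra_norm =
  fixes N :: "real ^ 'n::finite ^ 'n \<Rightarrow> real"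
  assumes triangle: "N (A + B) \<le> N A + N B"
    and scaleR: "N (c *\<^sub>R A) = \<bar>c\<bar> * N A"
    and submult: "N (A ** B) \<le> N A * N B"
    and norm_le: "\<exists>c. \<forall>A. norm A \<le> c * N A"
    and le_norm: "\<exists>c. \<forall>A. N A \<le> c * norm A"
begin

lemma nonneg: "0 \<le> N A"
  using triangle [of A "(- 1) *\<^sub>R A"] scaleR [of "-1" A] scaleR [of 0 A] by simp

lemma power_bound: "N A \<le> r \<Longrightarrow> N (matpow A n) \<le> N (mat 1) * r ^ n"
proof (induction n)
  case (Suc n)
  have "N (matpow A (Suc n)) \<le> N A * N (matpow A n)" by (simp add: submult)
  also have "\<dots> \<le> r * (N (mat 1) * r ^ n)"
    using Suc nonneg order_trans [OF nonneg Suc.prems] by (intro mult_mono) auto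
  finally show ?case by (simp add: mult_ac)
qed simp

lemma dpow_bound:
  assumes "N A \<le> r"
  shows "N (dpow A B n) \<le> N (mat 1) * (real n * r ^ (n - 1)) * N B"
proof (induction n)
  case 0
  then show ?case using scaleR [of 0 A] by simp
next
  case (Suc n)
  have r: "0 \<le> r" using order_trans [OF nonneg assms] .
  have "N (dpow A B (Suc n)) \<le> N (A ** dpow A B n) + N (B ** matpow A n)" by (simp add: triangle)
  also have "\<dots> \<le> N A * N (dpow A B n) + N B * N (matpow A n)"
    by (intro add_mono submult)
  also have "\<dots> \<le> r * (N (mat 1) * (real n * r ^ (n - 1)) * N B) + N B * (N (mat 1) * r ^ n)"
    using Suc assms r nonneg power_bound [OF assms] by (intro add_mono mult_mono) auto
  also have "\<dots> = N (mat 1) * (real (Suc n) * r ^ (Suc n - 1)) * N B"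
    by (cases n) (simp_all add: algebra_simps)
  finally show ?case .
qed

lemma d2pow_bound:
  assumes "N A \<le> r"
  shows "N (d2pow A B C n) \<le> N (mat 1) * (real n * real (n - 1) * r ^ (n - 2)) * (N B * N C)"
proof (induction n)
  case 0
  then show ?case using scaleR [of 0 A] by simp
next
  case (Suc n)
  have r: "0 \<le> r" using order_trans [OF nonneg assms] .
  have "N (d2pow A B C (Suc n)) \<le> N (A ** d2pow A B C n) + N (C ** dpow A B n) + N (B ** dpow A C n)"
    using triangle [of "A ** d2pow A B C n + C ** dpow A B n" "B ** dpow A C n"]
      triangle [of "A ** d2pow A B C n" "C ** dpow A B n"] by simp
  also have "\<dots> \<le> N A * N (d2pow A B C n) + N C * N (dpow A B n) + N B * N (dpow A C n)"
    by (intro add_mono submult)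
  also have "\<dots> \<le> r * (N (mat 1) * (real n * real (n - 1) * r ^ (n - 2)) * (N B * N C))
      + N C * (N (mat 1) * (real n * r ^ (n - 1)) * N B) + N B * (N (mat 1) * (real n * r ^ (n - 1)) * N C)"
    using Suc assms r nonneg dpow_bound [OF assms] by (intro add_mono mult_mono) auto
  also have "\<dots> = N (mat 1) * (real (Suc n) * real (Suc n - 1) * r ^ (Suc n - 2)) * (N B * N C)"
  proof (cases n)
    case (Suc m)
    then show ?thesis by (cases m) (simp_all add: algebra_simps)
  qed simp
  finally show ?case .
qed

text \<open>The bounds above in the standard norm; one constant serves both.\<close>

lemma dpow_norm_bound:
  obtains c where "0 \<le> c" and
    "\<And>n A B. N A \<le> r \<Longrightarrow> norm (dpow A B n) \<le> c * (real n * r ^ (n - 1)) * norm B"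
    "\<And>n A B C. N A \<le> r \<Longrightarrow>
       norm (d2pow A B C n) \<le> c * (real n * real (n - 1) * r ^ (n - 2)) * (norm B * norm C)"
proof -
  obtain c1 where c1: "norm A \<le> c1 * N A" for A using norm_le by blast
  obtain c2 where c2: "N A \<le> c2 * norm A" for A using le_norm by blast
  \<comment> \<open>the first bound needs one factor \<open>c2\<close> and the second one two, and their sum dominates both\<close>
  define K where "K = \<bar>c1\<bar> * N (mat 1) * (\<bar>c2\<bar> + \<bar>c2\<bar> * \<bar>c2\<bar>)"
  have c1': "norm A \<le> \<bar>c1\<bar> * N A" and c2': "N A \<le> \<bar>c2\<bar> * norm A" for A
    using c1 [of A] c2 [of A] by (meson abs_ge_self mult_right_mono nonneg norm_ge_zero order_trans)+
  show thesis
  proof (rule that [of K])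
    show "0 \<le> K" by (simp add: K_def nonneg)
  next
    fix n A B
    assume A: "N A \<le> r"
    define s where "s = real n * r ^ (n - 1)"
    have s: "0 \<le> s" using order_trans [OF nonneg A] by (simp add: s_def)
    have "norm (dpow A B n) \<le> \<bar>c1\<bar> * (N (mat 1) * s * N B)"
      using c1' [of "dpow A B n"] mult_left_mono [OF dpow_bound [OF A, of B n], of "\<bar>c1\<bar>"]
      by (simp add: s_def)
    also have "\<dots> \<le> \<bar>c1\<bar> * (N (mat 1) * s * (\<bar>c2\<bar> * norm B))"
      using c2' s nonneg by (intro mult_left_mono mult_nonneg_nonneg) auto
    also have "\<dots> \<le> \<bar>c1\<bar> * (N (mat 1) * s * ((\<bar>c2\<bar> + \<bar>c2\<bar> * \<bar>c2\<bar>) * norm B))"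
      using s nonneg by (intro mult_left_mono mult_nonneg_nonneg mult_right_mono) auto
    finally show "norm (dpow A B n) \<le> K * (real n * r ^ (n - 1)) * norm B"
      by (simp add: K_def s_def mult_ac)
  next
    fix n A B C
    assume A: "N A \<le> r"
    define s where "s = real n * real (n - 1) * r ^ (n - 2)"
    have s: "0 \<le> s" using order_trans [OF nonneg A] by (simp add: s_def)
    have "norm (d2pow A B C n) \<le> \<bar>c1\<bar> * (N (mat 1) * s * (N B * N C))"
      using c1' [of "d2pow A B C n"] mult_left_mono [OF d2pow_bound [OF A, of B C n], of "\<bar>c1\<bar>"]
      by (simp add: s_def)
    also have "\<dots> \<le> \<bar>c1\<bar> * (N (mat 1) * s * ((\<bar>c2\<bar> * norm B) * (\<bar>c2\<bar> * norm C)))"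
      using c2' s nonneg by (intro mult_left_mono mult_nonneg_nonneg mult_mono) auto
    also have "\<dots> = \<bar>c1\<bar> * (N (mat 1) * s * ((\<bar>c2\<bar> * \<bar>c2\<bar>) * (norm B * norm C)))"
      by (simp add: mult_ac)
    also have "\<dots> \<le> \<bar>c1\<bar> * (N (mat 1) * s * ((\<bar>c2\<bar> + \<bar>c2\<bar> * \<bar>c2\<bar>) * (norm B * norm C)))"
      using s nonneg by (intro mult_left_mono mult_nonneg_nonneg mult_right_mono) auto
    finally show "norm (d2pow A B C n) \<le> K * (real n * real (n - 1) * r ^ (n - 2)) * (norm B * norm C)"
      by (simp add: K_def s_def mult_ac)
  qed
qed

lemma open_ball: "open {A. N A < r}" and convex_ball: "convex {A. N A < r}"
proof -
  obtain c where c: "N A \<le> c * norm A" for A using le_norm by blast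
  have "\<bar>N A - N B\<bar> \<le> c * norm (A - B)" for A B
    using triangle [of "A - B" B] triangle [of "B - A" A] c [of "A - B"] c [of "B - A"]
    by (simp add: norm_minus_commute)
  then have "\<bar>N A - N B\<bar> \<le> \<bar>c\<bar> * norm (A - B)" for A B
    by (meson abs_ge_self mult_right_mono norm_ge_zero order_trans)
  then have "\<bar>c\<bar>-lipschitz_on UNIV N"
    by (intro lipschitz_onI) (auto simp: dist_norm)
  then have "continuous_on UNIV N"
    by (rule lipschitz_on_continuous_on)
  then show "open {A. N A < r}"
    by (intro open_Collect_less continuous_on_const)
  show "convex {A. N A < r}"
  proof (rule convexI)
    fix A B u v
    assume *: "A \<in> {A. N A < r}" "B \<in> {A. N A < r}" "0 \<le> u" "0 \<le> v" "u + v = (1::real)"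
    have "N (u *\<^sub>R A + v *\<^sub>R B) \<le> u * N A + v * N B"
      using triangle [of "u *\<^sub>R A" "v *\<^sub>R B"] * by (simp add: scaleR)
    also have "\<dots> < r" using * by (intro convex_bound_lt) auto
    finally show "u *\<^sub>R A + v *\<^sub>R B \<in> {A. N A < r}" by simp
  qed
qed

end

locale matrix_power_series = matrix_algebra_norm N for N :: "real ^ 'n::finite ^ 'n \<Rightarrow> real" +
  fixes a :: "nat \<Rightarrow> real" and R :: real
  assumes conv: "\<And>x. \<bar>x\<bar> < R \<Longrightarrow> summable (\<lambda>n. a n * x ^ n)"
begin

lemma abs_conv:
  assumes "\<bar>x\<bar> < R"
  shows "summable (\<lambda>n. \<bar>a n\<bar> * x ^ n)"
proof -
  obtain y where "\<bar>x\<bar> < y" "y < R" using assms dense by blast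
  then have "summable (\<lambda>n. norm (a n * \<bar>x\<bar> ^ n))"
    using powser_insidea [where f = a, OF conv, of y "\<bar>x\<bar>"] by simp
  then have "summable (\<lambda>n. norm (\<bar>a n\<bar> * x ^ n))"
    by (simp add: abs_mult power_abs)
  then show ?thesis by (rule summable_norm_cancel)
qed

lemma abs_conv_diff:
  assumes "\<bar>x\<bar> < R"
  shows "summable (\<lambda>n. \<bar>a n\<bar> * (real n * x ^ (n - 1)))"
proof (subst summable_Suc_iff [symmetric])
  show "summable (\<lambda>n. \<bar>a (Suc n)\<bar> * (real (Suc n) * x ^ (Suc n - 1)))"
    using termdiff_converges [of x R "\<lambda>n. \<bar>a n\<bar>"] abs_conv assms by (simp add: diffs_def mult_ac)
qed

lemma abs_conv_diff2:
  assumes "\<bar>x\<bar> < R"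
  shows "summable (\<lambda>n. \<bar>a n\<bar> * (real n * real (n - 1) * x ^ (n - 2)))"
proof (subst summable_Suc_iff [symmetric], subst summable_Suc_iff [symmetric])
  have "summable (\<lambda>n. diffs (diffs (\<lambda>n. \<bar>a n\<bar>)) n * x ^ n)"
    using assms abs_conv by (intro termdiff_converges [where K = R]) auto
  then show "summable (\<lambda>n. \<bar>a (Suc (Suc n))\<bar> * (real (Suc (Suc n)) * real (Suc (Suc n) - 1) * x ^ (Suc (Suc n) - 2)))"
    by (simp add: diffs_def mult_ac)
qed

lemma summable_norm_powers:
  assumes "N A < R"
  shows "summable (\<lambda>n. norm (a n *\<^sub>R matpow A n))"
proof -
  obtain c where c: "norm A \<le> c * N A" for A using norm_le by blast
  have "norm (a n *\<^sub>R matpow A n) \<le> \<bar>c\<bar> * N (mat 1) * (\<bar>a n\<bar> * N A ^ n)" for n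
  proof -
    have "norm (matpow A n) \<le> \<bar>c\<bar> * N (matpow A n)"
      using c [of "matpow A n"] by (meson abs_ge_self mult_right_mono nonneg order_trans)
    also have "\<dots> \<le> \<bar>c\<bar> * (N (mat 1) * N A ^ n)"
      using power_bound [of A "N A"] by (intro mult_left_mono) auto
    finally show ?thesis
      using mult_left_mono [of _ _ "\<bar>a n\<bar>"] by (fastforce simp: mult_ac)
  qed
  moreover have "summable (\<lambda>n. \<bar>c\<bar> * N (mat 1) * (\<bar>a n\<bar> * N A ^ n))"
    by (rule summable_mult, rule abs_conv) (use assms nonneg [of A] in simp)
  ultimately show ?thesis
    by - (rule summable_comparison_test' [where N = 0], assumption, simp)
qed

lemma summable_dpow:
  assumes "N A < R"
  shows "summable (\<lambda>n. a n *\<^sub>R dpow A B n)"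
proof -
  obtain c where c: "norm (dpow A B n) \<le> c * (real n * N A ^ (n - 1)) * norm B" for n
    using dpow_norm_bound [of "N A"] by (metis order_refl)
  have "norm (a n *\<^sub>R dpow A B n) \<le> c * (\<bar>a n\<bar> * (real n * N A ^ (n - 1))) * norm B" for n
    using mult_left_mono [OF c [of n], of "\<bar>a n\<bar>"] by (simp add: mult_ac)
  moreover have "summable (\<lambda>n. c * (\<bar>a n\<bar> * (real n * N A ^ (n - 1))) * norm B)"
    by (rule summable_mult2, rule summable_mult, rule abs_conv_diff) (use assms nonneg [of A] in simp)
  ultimately show ?thesis by - (rule summable_comparison_test' [where N = 0], assumption)
qed

lemma summable_d2pow:
  assumes "N A < R"
  shows "summable (\<lambda>n. a n *\<^sub>R d2pow A B C n)"
proof -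
  obtain c where c: "norm (d2pow A B C n) \<le> c * (real n * real (n - 1) * N A ^ (n - 2)) * (norm B * norm C)" for n
    using dpow_norm_bound [of "N A"] by (metis order_refl)
  have "norm (a n *\<^sub>R d2pow A B C n) \<le>
      c * (\<bar>a n\<bar> * (real n * real (n - 1) * N A ^ (n - 2))) * (norm B * norm C)" for n
    using mult_left_mono [OF c [of n], of "\<bar>a n\<bar>"] by (simp add: mult_ac)
  moreover have "summable (\<lambda>n. c * (\<bar>a n\<bar> * (real n * real (n - 1) * N A ^ (n - 2))) * (norm B * norm C))"
    by (rule summable_mult2, rule summable_mult, rule abs_conv_diff2) (use assms nonneg [of A] in simp)
  ultimately show ?thesis by - (rule summable_comparison_test' [where N = 0], assumption)
qed

text \<open>
  A slightly larger radius \<open>r\<close> than \<open>N A\<close> gives a whole ball around \<open>A\<close> on which the terms are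
  dominated by the termwise derivative of the scalar series at \<open>r\<close>.
\<close>
lemma has_derivative_power_series:
  assumes "N A < R"
  shows "((\<lambda>A. \<Sum>n. a n *\<^sub>R matpow A n) has_derivative (\<lambda>B. \<Sum>n. a n *\<^sub>R dpow A B n)) (at A)"
proof -
  obtain r where r: "N A < r" "r < R" using assms dense by blast
  have r0: "0 \<le> r" using nonneg [of A] r by simp
  obtain c where c: "0 \<le> c" "\<And>A B n. N A \<le> r \<Longrightarrow> norm (dpow A B n) \<le> c * (real n * r ^ (n - 1)) * norm B"
    using dpow_norm_bound [of r] by metis
  show ?thesis
  proof (rule has_derivative_suminf
      [where S = "{A. N A < r}" and b = "\<lambda>n. c * (\<bar>a n\<bar> * (real n * r ^ (n - 1)))"])
    show "((\<lambda>A. a n *\<^sub>R matpow A n) has_derivative (\<lambda>B. a n *\<^sub>R dpow B' B n)) (at B')" for n B'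
      by (intro has_derivative_scaleR_right has_derivative_matpow)
    show "norm (a n *\<^sub>R dpow y B n) \<le> c * (\<bar>a n\<bar> * (real n * r ^ (n - 1))) * norm B"
      if "y \<in> {A. N A < r}" for y B n
      using mult_left_mono [OF c(2) [of y B n], of "\<bar>a n\<bar>"] that by (simp add: mult_ac)
    show "summable (\<lambda>n. c * (\<bar>a n\<bar> * (real n * r ^ (n - 1))))"
      by (rule summable_mult, rule abs_conv_diff) (use r r0 in simp)
    show "summable (\<lambda>n. a n *\<^sub>R matpow A n)"
      using summable_norm_powers [OF assms] by (rule summable_norm_cancel)
  qed (use r r0 c(1) in \<open>auto intro: open_ball convex_ball\<close>)
qed

lemma has_derivative_dpow_series:
  assumes "N A < R"
  shows "((\<lambda>A. \<Sum>n. a n *\<^sub>R dpow A B n) has_derivative (\<lambda>C. \<Sum>n. a n *\<^sub>R d2pow A B C n)) (at A)"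
proof -
  obtain r where r: "N A < r" "r < R" using assms dense by blast
  have r0: "0 \<le> r" using nonneg [of A] r by simp
  obtain c where c: "0 \<le> c" "\<And>A C n. N A \<le> r \<Longrightarrow>
      norm (d2pow A B C n) \<le> c * (real n * real (n - 1) * r ^ (n - 2)) * (norm B * norm C)"
    using dpow_norm_bound [of r] by metis
  show ?thesis
  proof (rule has_derivative_suminf [where S = "{A. N A < r}"
        and b = "\<lambda>n. c * (\<bar>a n\<bar> * (real n * real (n - 1) * r ^ (n - 2))) * norm B"])
    show "((\<lambda>A. a n *\<^sub>R dpow A B n) has_derivative (\<lambda>C. a n *\<^sub>R d2pow B' B C n)) (at B')" for n B'
      by (intro has_derivative_scaleR_right has_derivative_dpow)
    show "norm (a n *\<^sub>R d2pow y B C n) \<le>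
        c * (\<bar>a n\<bar> * (real n * real (n - 1) * r ^ (n - 2))) * norm B * norm C"
      if "y \<in> {A. N A < r}" for y C n
      using mult_left_mono [OF c(2) [of y C n], of "\<bar>a n\<bar>"] that by (simp add: mult_ac)
    show "summable (\<lambda>n. c * (\<bar>a n\<bar> * (real n * real (n - 1) * r ^ (n - 2))) * norm B)"
      by (rule summable_mult2, rule summable_mult, rule abs_conv_diff2) (use r r0 in simp)
    show "summable (\<lambda>n. a n *\<^sub>R dpow A B n)"
      by (rule summable_dpow [OF assms])
  qed (use r r0 c(1) in \<open>auto intro: open_ball convex_ball\<close>)
qed

end

section \<open>Products of matrix series\<close>

text \<open>Each entry of the product is a finite sum of products of scalar series.\<close>
lemma matrix_Cauchy_product_sums:
  fixes f :: "nat \<Rightarrow> real ^ 'n::finite ^ 'm::finite" and g :: "nat \<Rightarrow> real ^ 'k::finite ^ 'n"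
  assumes f: "summable (\<lambda>n. norm (f n))" and g: "summable (\<lambda>n. norm (g n))"
  shows "(\<lambda>n. \<Sum>i\<le>n. f i ** g (n - i)) sums ((\<Sum>n. f n) ** (\<Sum>n. g n))"
proof -
  have entry: "summable (\<lambda>n. norm (h n $ i $ j))" "(\<Sum>n. h n $ i $ j) = (\<Sum>n. h n) $ i $ j"
    if h: "summable (\<lambda>n. norm (h n))" for h :: "nat \<Rightarrow> real ^ 'b::finite ^ 'a::finite" and i j
  proof -
    have "norm (h n $ i $ j) \<le> norm (h n)" for n
      using Finite_Cartesian_Product.norm_nth_le [of "h n $ i" j] Finite_Cartesian_Product.norm_nth_le [of "h n" i]
      by linarith
    then show "summable (\<lambda>n. norm (h n $ i $ j))"
      by (intro summable_comparison_test' [OF h, of 0]) simp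
    have "bounded_linear (\<lambda>M :: real ^ 'b ^ 'a. M $ i $ j)"
      using bounded_linear_compose [OF bounded_linear_vec_nth bounded_linear_vec_nth] .
    from bounded_linear.suminf [OF this summable_norm_cancel [OF h]]
    show "(\<Sum>n. h n $ i $ j) = (\<Sum>n. h n) $ i $ j" by simp
  qed
  have "(\<lambda>n. (\<Sum>i\<le>n. f i ** g (n - i)) $ a $ b) sums ((\<Sum>n. f n) ** (\<Sum>n. g n)) $ a $ b" for a b
  proof -
    have "(\<lambda>n. \<Sum>c\<in>UNIV. \<Sum>i\<le>n. f i $ a $ c * g (n - i) $ c $ b) sums
        (\<Sum>c\<in>UNIV. (\<Sum>n. f n $ a $ c) * (\<Sum>n. g n $ c $ b))"
      by (intro sums_sum Cauchy_product_sums entry f g)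
    then show ?thesis
      by (subst (asm) sum.swap) (simp add: matrix_matrix_mult_def entry(2) f g)
  qed
  then show ?thesis
    unfolding sums_def by (intro vec_tendstoI) simp
qed

lemma matpow_add: "matpow A m ** matpow A n = matpow A (m + n)"
  by (induction m) (simp_all add: matrix_mul_assoc [symmetric])

lemma matrix_power_series_mult:
  assumes "summable (\<lambda>n. norm (a n *\<^sub>R matpow A n))" "summable (\<lambda>n. norm (b n *\<^sub>R matpow A n))"
  shows "(\<lambda>n. (\<Sum>i\<le>n. a i * b (n - i)) *\<^sub>R matpow A n) sums
      ((\<Sum>n. a n *\<^sub>R matpow A n) ** (\<Sum>n. b n *\<^sub>R matpow A n))"
  using matrix_Cauchy_product_sums [OF assms]
  by (simp add: matrix_mult.scaleR_left matrix_mult.scaleR_right matpow_add scaleR_sum_left mult.commute)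

lemma matrix_power_series_inverse:
  assumes "summable (\<lambda>n. norm (a n *\<^sub>R matpow A n))" "summable (\<lambda>n. norm (b n *\<^sub>R matpow A n))"
    and "\<And>n. (\<Sum>i\<le>n. a i * b (n - i)) = (if n = 0 then 1 else 0)"
  shows "(\<Sum>n. a n *\<^sub>R matpow A n) ** (\<Sum>n. b n *\<^sub>R matpow A n) = mat 1"
proof -
  have "(\<Sum>i\<le>n. a i * b (n - i)) *\<^sub>R matpow A n = (if n = 0 then mat 1 else 0)" for n
    unfolding assms(3) by simp
  then have "(\<lambda>n. if n = 0 then mat 1 else 0) sums
      ((\<Sum>n. a n *\<^sub>R matpow A n) ** (\<Sum>n. b n *\<^sub>R matpow A n))"
    using matrix_power_series_mult [OF assms(1,2)] by (simp only:)
  from sums_unique2 [OF this sums_single [of 0 "\<lambda>_. mat 1"]] show ?thesis .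
qed

section \<open>Operator norms up to conjugation\<close>

text \<open>
  The operator norm of the matrix \<open>A\<close> after a change of basis; \<open>D'\<close> is meant to be the inverse of
  \<open>D\<close>.
\<close>

definition conj_norm :: "real ^ 'n::finite ^ 'n \<Rightarrow> real ^ 'n ^ 'n \<Rightarrow> real ^ 'n ^ 'n \<Rightarrow> real" where
  "conj_norm D D' A = onorm ((*v) (D ** A ** D'))"

lemma norm_le_onorm_matrix:
  fixes M :: "real ^ 'n::finite ^ 'n"
  shows "norm M \<le> real CARD('n) * real CARD('n) * onorm ((*v) M)"
proof -
  have "norm (M $ i) \<le> real CARD('n) * onorm ((*v) M)" for i
  proof -
    have "norm (M $ i) \<le> (\<Sum>j\<in>UNIV. \<bar>M $ i $ j\<bar>)" by (rule norm_le_l1_cart)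
    also have "\<dots> \<le> (\<Sum>j\<in>(UNIV :: 'n set). onorm ((*v) M))"
      by (intro sum_mono matrix_component_le_onorm)
    finally show ?thesis by simp
  qed
  then have "(\<Sum>i\<in>UNIV. norm (M $ i)) \<le> (\<Sum>i\<in>(UNIV :: 'n set). real CARD('n) * onorm ((*v) M))"
    by (intro sum_mono)
  moreover have "norm M \<le> (\<Sum>i\<in>UNIV. norm (M $ i))"
    unfolding norm_vec_def [of M] by (rule L2_set_le_sum) simp
  ultimately show ?thesis by simp
qed

lemma matrix_algebra_norm_conj_norm:
  fixes D D' :: "real ^ 'n::finite ^ 'n"
  assumes inv: "D' ** D = mat 1"
  shows "matrix_algebra_norm (conj_norm D D')"
proof
  fix A B :: "real ^ 'n ^ 'n" and c :: real
  have bl: "bounded_linear ((*v) M)" for M :: "real ^ 'n ^ 'n" by simp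
  have "(*v) (D ** (A + B) ** D') = (\<lambda>x. D ** A ** D' *v x + D ** B ** D' *v x)"
    by (simp add: fun_eq_iff matrix_mult.add_left matrix_mult.add_right matrix_vector.add_left)
  then show "conj_norm D D' (A + B) \<le> conj_norm D D' A + conj_norm D D' B"
    unfolding conj_norm_def by (simp add: onorm_triangle [OF bl bl])
  have "(*v) (D ** (c *\<^sub>R A) ** D') = (\<lambda>x. c *\<^sub>R (D ** A ** D' *v x))"
    by (simp add: fun_eq_iff matrix_mult.scaleR_left matrix_mult.scaleR_right matrix_vector.scaleR_left)
  then show "conj_norm D D' (c *\<^sub>R A) = \<bar>c\<bar> * conj_norm D D' A"
    unfolding conj_norm_def by (simp add: onorm_scaleR [OF bl])
  have "D ** (A ** B) ** D' = (D ** A ** (D' ** D)) ** B ** D'"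
    by (simp add: inv matrix_mul_assoc)
  also have "\<dots> = (D ** A ** D') ** (D ** B ** D')"
    by (simp only: matrix_mul_assoc)
  finally have "(*v) (D ** (A ** B) ** D') = (*v) (D ** A ** D') \<circ> (*v) (D ** B ** D')"
    by (simp add: fun_eq_iff matrix_vector_mul_assoc)
  then show "conj_norm D D' (A ** B) \<le> conj_norm D D' A * conj_norm D D' B"
    unfolding conj_norm_def by (simp add: onorm_compose [OF bl bl])
next
  obtain K where K: "0 < K" "\<And>(A :: real ^ 'n ^ 'n) (B :: real ^ 'n ^ 'n). norm (A ** B) \<le> norm A * norm B * K"
    using matrix_mult.pos_bounded by blast
  obtain K' where K': "0 < K'" "\<And>(A :: real ^ 'n ^ 'n) x. norm (A *v x) \<le> norm A * norm x * K'"
    using matrix_vector.pos_bounded by blast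
  have norm3: "norm (A ** B ** C) \<le> norm A * norm C * K * K * norm B" for A B C :: "real ^ 'n ^ 'n"
    using order_trans [OF K(2) [of "A ** B" C]
        mult_right_mono [OF mult_right_mono [OF K(2) [of A B], of "norm C"], of K]] K(1)
    by (simp add: mult_ac)
  have "norm A \<le> norm D' * norm D * K * K * (real CARD('n) * real CARD('n)) * conj_norm D D' A" for A
  proof -
    have "A = D' ** (D ** A ** D') ** D"
      using inv matrix_left_right_inverse [of D D'] by (metis matrix_mul_assoc matrix_mul_lid matrix_mul_rid)
    then have "norm A \<le> norm D' * norm D * K * K * norm (D ** A ** D')"
      using norm3 by metis
    also have "\<dots> \<le> norm D' * norm D * K * K * (real CARD('n) * real CARD('n) * conj_norm D D' A)"
      unfolding conj_norm_def using K(1) by (intro mult_left_mono norm_le_onorm_matrix) auto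
    finally show ?thesis by (simp add: mult_ac)
  qed
  then show "\<exists>c. \<forall>A. norm A \<le> c * conj_norm D D' A" by blast
  have "conj_norm D D' A \<le> K' * (norm D * norm D' * K * K) * norm A" for A
  proof -
    have "conj_norm D D' A \<le> K' * norm (D ** A ** D')"
      unfolding conj_norm_def
      by (rule onorm_le) (use K'(2) in \<open>simp add: mult_ac\<close>)
    also have "\<dots> \<le> K' * (norm D * norm D' * K * K * norm A)"
      using K'(1) norm3 by (intro mult_left_mono) auto
    finally show ?thesis by (simp add: mult_ac)
  qed
  then show "\<exists>c. \<forall>A. conj_norm D D' A \<le> c * norm A" by blast
qed

section \<open>The differential of the matrix exponential\<close>

text \<open>
  The exponential series dominates the series \<open>a\<close>, so that it converges everywhere and the radius
  \<open>R\<close> is arbitrary.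
\<close>

lemma matrix_power_series_exp:
  assumes "\<And>n. \<bar>a n\<bar> \<le> 1 / fact n"
  shows "matrix_power_series (conj_norm (mat 1) (mat 1)) a R"
proof -
  interpret matrix_algebra_norm "conj_norm (mat 1) (mat 1)"
    by (rule matrix_algebra_norm_conj_norm) simp
  show ?thesis
  proof
    fix x :: real
    have "norm (a n * x ^ n) \<le> 1 / fact n * \<bar>x\<bar> ^ n" for n
      using mult_right_mono [OF assms, of "\<bar>x\<bar> ^ n" n] by (simp add: abs_mult power_abs)
    moreover have "summable (\<lambda>n. 1 / fact n * \<bar>x\<bar> ^ n)"
      using summable_exp [of "\<bar>x\<bar>"] by (simp add: divide_inverse)
    ultimately show "summable (\<lambda>n. a n * x ^ n)"
      by - (rule summable_comparison_test' [where N = 0], assumption)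
  qed
qed

lemma summable_norm_matrix_power_series_exp:
  assumes "\<And>n. \<bar>a n\<bar> \<le> 1 / fact n"
  shows "summable (\<lambda>n. norm (a n *\<^sub>R matpow A n))"
proof -
  interpret matrix_power_series "conj_norm (mat 1) (mat 1)" a "conj_norm (mat 1) (mat 1) A + 1"
    by (rule matrix_power_series_exp) (simp_all add: assms)
  show ?thesis by (rule summable_norm_powers) simp
qed

lemma matexp_mult_minus: "matexp A ** matexp (- A) = mat 1"
proof -
  have minus: "matpow (- A) n = (-1) ^ n *\<^sub>R matpow A n" for n
    by (induction n) (simp_all add: matrix_mult.minus_left matrix_mult.scaleR_right)
  have "(\<Sum>n. (1 / fact n) *\<^sub>R matpow A n) ** (\<Sum>n. ((-1) ^ n / fact n) *\<^sub>R matpow A n) = mat 1"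
  proof (intro matrix_power_series_inverse summable_norm_matrix_power_series_exp)
    fix n :: nat
    have "(\<Sum>i\<le>n. 1 / fact i * ((-1) ^ (n - i) / fact (n - i))) = ((1 + (-1)) ^ n / fact n :: real)"
      using exp_series_add_commuting [of "1 :: real" "-1" n] by (simp add: field_simps)
    then show "(\<Sum>i\<le>n. 1 / fact i * ((-1) ^ (n - i) / fact (n - i))) = (if n = 0 then 1 else (0 :: real))"
      by simp
  qed auto
  then show ?thesis by (simp add: matexp_def minus)
qed

lemma has_derivative_matexp:
  "(matexp has_derivative (\<lambda>B. \<Sum>n. (1 / fact n) *\<^sub>R dpow A B n)) (at A)"
proof -
  interpret matrix_power_series "conj_norm (mat 1) (mat 1)" "\<lambda>n. 1 / fact n" "conj_norm (mat 1) (mat 1) A + 1"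
    by (rule matrix_power_series_exp) simp_all
  show ?thesis
    using has_derivative_power_series [of A] by (simp add: matexp_def [abs_def])
qed

text \<open>
  The classical formula \<open>D exp(A)(B) = (\<Sum>i. ad\<^sub>A\<^sup>i B / (i + 1)!) exp A\<close>, where \<open>c i\<close> is the \<open>i\<close>-fold
  commutator of \<open>A\<close> with \<open>B = c 0\<close>. The commutator expansion of \<open>dpow\<close>, divided by factorials, is
  exactly the Cauchy product of the two series on the right.
\<close>
lemma suminf_dpow_exp:
  fixes A :: "real ^ 'n::finite ^ 'n"
  assumes c: "\<And>i. A ** c i = c (Suc i) + c i ** A"
    and sum_c: "summable (\<lambda>i. norm ((1 / fact (Suc i)) *\<^sub>R c i))"
  shows "(\<Sum>n. (1 / fact n) *\<^sub>R dpow A (c 0) n) = (\<Sum>i. (1 / fact (Suc i)) *\<^sub>R c i) ** matexp A"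
proof -
  have product_term: "(\<Sum>i\<le>n. ((1 / fact (Suc i)) *\<^sub>R c i) ** ((1 / fact (n - i)) *\<^sub>R matpow A (n - i))) =
      (1 / fact (Suc n)) *\<^sub>R dpow A (c 0) (Suc n)" for n
  proof -
    have coeff: "1 / fact (Suc i) * (1 / fact (n - i)) = (1 / fact (Suc n)) * real (Suc n choose Suc i)"
      if "i \<le> n" for i
      using binomial_fact [of "Suc i" "Suc n", where 'a = real] that by simp
    show ?thesis
      unfolding dpow_eq_commutator_sum [where A = A and c = c, OF c] scaleR_sum_right lessThan_Suc_atMost
      by (intro sum.cong refl)
        (simp only: coeff atMost_iff matrix_mult.scaleR_left matrix_mult.scaleR_right scaleR_scaleR
          diff_Suc_Suc mult.commute [of "1 / fact (n - _)"])
  qed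
  have "(\<lambda>n. (1 / fact (Suc n)) *\<^sub>R dpow A (c 0) (Suc n)) sums
      ((\<Sum>i. (1 / fact (Suc i)) *\<^sub>R c i) ** matexp A)"
    using matrix_Cauchy_product_sums [OF sum_c summable_norm_matrix_power_series_exp [of "\<lambda>n. 1 / fact n" A]]
    unfolding matexp_def product_term by simp
  then show ?thesis
    using sums_Suc_iff [of "\<lambda>n. (1 / fact n) *\<^sub>R dpow A (c 0) n"] sums_unique by fastforce
qed

section \<open>The right-trivialized differential on SE(3) as a power series\<close>

lemma sum_UNIV_plus: "(\<Sum>k\<in>UNIV. f k) = (\<Sum>a\<in>UNIV. f (Inl a)) + (\<Sum>a\<in>UNIV. f (Inr a))"
  for f :: "'a::finite + 'b::finite \<Rightarrow> 'c::comm_monoid_add"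
  by (simp add: UNIV_Plus_UNIV [symmetric] sum.Plus del: UNIV_Plus_UNIV)

lemma ad_mult_vec:
  "ad X *v V = (\<chi> i. case i of
     Inl a \<Rightarrow> cross3 (ang X) (ang V) $ a
   | Inr b \<Rightarrow> cross3 (lin X) (ang V) $ b + cross3 (ang X) (lin V) $ b)"
proof -
  have skew: "(\<Sum>a\<in>UNIV. skew x $ i $ a * w $ a) = cross3 x w $ i" for x w i
    using skew_mult_vec [of x w] by (simp add: matrix_vector_mult_def vec_eq_iff)
  show ?thesis
    using skew [of "ang X" _ "ang V"] skew [of "ang X" _ "lin V"] skew [of "lin X" _ "ang V"]
    by (simp add: vec_eq_iff matrix_vector_mult_def ad_def block_mat_def sum_UNIV_plus
        ang_def [of V] lin_def [of V] split: sum.split)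
qed

lemma ang_ad [simp]: "ang (ad X *v V) = cross3 (ang X) (ang V)"
  and lin_ad [simp]: "lin (ad X *v V) = cross3 (lin X) (ang V) + cross3 (ang X) (lin V)"
  by (simp_all add: ad_mult_vec ang_def [of "vec_lambda _"] lin_def [of "vec_lambda _"] vec_eq_iff)

lemma vec6_eq_iff: "X = Y \<longleftrightarrow> ang X = ang Y \<and> lin X = lin Y"
  by (simp add: vec_eq_iff ang_def lin_def split_sum_all)

lemma linear_ang: "linear ang" and linear_lin: "linear lin"
  by (simp_all add: linear_iff ang_def lin_def vec_eq_iff)

lemma linear_skew: "linear skew"
proof -
  have "skew (x + y) *v w = (skew x + skew y) *v w" "skew (c *\<^sub>R x) *v w = (c *\<^sub>R skew x) *v w" for x y w c
    by (simp_all add: skew_mult_vec matrix_vector.add_left matrix_vector.scaleR_left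
        cross_add_left cross_mult_left)
  then show ?thesis by (simp add: linear_iff matrix_eq)
qed

lemma bounded_linear_ad: "bounded_linear ad"
proof -
  have "linear ad"
    by (simp add: linear_iff ad_def block_mat_def vec_eq_iff split_sum_all linear_add [OF linear_ang]
        linear_add [OF linear_lin] linear_scale [OF linear_ang] linear_scale [OF linear_lin]
        linear_add [OF linear_skew] linear_scale [OF linear_skew])
  then show ?thesis by (simp add: linear_conv_bounded_linear)
qed

lemma bounded_linear_se3_hat: "bounded_linear se3_hat"
proof -
  have "linear se3_hat"
    by (simp add: linear_iff se3_hat_def block_mat_def vec_eq_iff split_sum_all linear_add [OF linear_ang]
        linear_add [OF linear_lin] linear_scale [OF linear_ang] linear_scale [OF linear_lin]
        linear_add [OF linear_skew] linear_scale [OF linear_skew])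
  then show ?thesis by (simp add: linear_conv_bounded_linear)
qed

lemma ad_antisym: "ad X *v V = - (ad V *v X)"
  using cross_skew [of "ang X"] cross_skew [of "lin X"]
  by (simp add: vec6_eq_iff linear_neg [OF linear_ang] linear_neg [OF linear_lin])

lemma skew_entries:
  "skew v $ 1 $ 1 = 0" "skew v $ 1 $ 2 = - v $ 3" "skew v $ 1 $ 3 = v $ 2"
  "skew v $ 2 $ 1 = v $ 3" "skew v $ 2 $ 2 = 0" "skew v $ 2 $ 3 = - v $ 1"
  "skew v $ 3 $ 1 = - v $ 2" "skew v $ 3 $ 2 = v $ 1" "skew v $ 3 $ 3 = 0"
  by (simp_all add: skew_def matrix_def cross3_def axis_def)

lemma inj_se3_hat:
  assumes "se3_hat X = se3_hat Y"
  shows "X = Y"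
proof -
  from assms have "skew (ang X) = skew (ang Y)" and lin: "lin X = lin Y"
    by (auto simp: se3_hat_def block_mat_def vec_eq_iff split_sum_all)
  from this(1) have "skew (ang X) $ i $ j = skew (ang Y) $ i $ j" for i j by simp
  from this [of 3 2] this [of 1 3] this [of 2 1] have "ang X = ang Y"
    by (simp add: skew_entries vec_eq_iff forall_3)
  with lin show ?thesis by (simp add: vec6_eq_iff)
qed

text \<open>The hat map is a homomorphism of Lie algebras.\<close>
lemma se3_hat_commutator: "se3_hat X ** se3_hat V = se3_hat (ad X *v V) + se3_hat V ** se3_hat X"
  by (simp add: vec_eq_iff split_sum_all forall_3 matrix_matrix_mult_def se3_hat_def block_mat_def
      sum_UNIV_plus sum_3 skew_entries cross3_simps)

lemma summable_norm_bounded_linear: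
  assumes "bounded_linear L" and "summable (\<lambda>n. norm (f n))"
  shows "summable (\<lambda>n. norm (L (f n)))"
proof -
  obtain K where K: "\<And>x. norm (L x) \<le> norm x * K"
    using bounded_linear.bounded [OF assms(1)] by blast
  show ?thesis
    by (rule summable_comparison_test' [OF summable_mult2 [OF assms(2), of K], of 0]) (simp add: K)
qed

definition dexp_series :: "vec6 \<Rightarrow> mat6" where
  "dexp_series X = (\<Sum>i. (1 / fact (i + 1)) *\<^sub>R P i X)"

lemma dexp_coeff_bound: "\<bar>1 / fact (i + 1) :: real\<bar> \<le> 1 / fact i"
  by (simp add: frac_le fact_mono)

text \<open>
  The iterated commutators of the hat matrices of \<open>X\<close> and \<open>U\<close> are the hat matrices of
  \<open>P i X *v U\<close>, so the formula for the differential of the matrix exponential becomes a power series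
  in \<open>ad X\<close>.
\<close>
lemma has_derivative_se3_exp:
  "(se3_exp has_derivative (\<lambda>U. se3_hat (dexp_series X *v U) ** se3_exp X)) (at X)"
proof -
  have sum_P: "summable (\<lambda>i. norm ((1 / fact (i + 1)) *\<^sub>R P i X))"
    unfolding P_def by (rule summable_norm_matrix_power_series_exp [OF dexp_coeff_bound])
  have "(se3_hat has_derivative se3_hat) (at X)"
    by (rule bounded_linear_imp_has_derivative [OF bounded_linear_se3_hat])
  from diff_chain_at [OF this has_derivative_matexp [of "se3_hat X"]]
  have "(se3_exp has_derivative (\<lambda>U. \<Sum>n. (1 / fact n) *\<^sub>R dpow (se3_hat X) (se3_hat U) n)) (at X)"
    unfolding o_def se3_exp_def [abs_def] .
  moreover have "(\<Sum>n. (1 / fact n) *\<^sub>R dpow (se3_hat X) (se3_hat U) n) =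
      se3_hat (dexp_series X *v U) ** se3_exp X" for U
  proof -
    define c where "c i = se3_hat (P i X *v U)" for i
    have c: "se3_hat X ** c i = c (Suc i) + c i ** se3_hat X" for i
      unfolding c_def by (subst se3_hat_commutator) (simp add: P_def matrix_vector_mul_assoc)
    have bl: "bounded_linear (\<lambda>M. se3_hat (M *v U))"
      by (rule bounded_linear_compose [OF bounded_linear_se3_hat matrix_vector.bounded_linear_left])
    have scale: "se3_hat (((1 / fact (i + 1)) *\<^sub>R P i X) *v U) = (1 / fact (Suc i)) *\<^sub>R c i" for i
      using linear_scale [OF bounded_linear.linear [OF bl]] by (simp add: c_def)
    have "summable (\<lambda>i. norm (se3_hat (((1 / fact (i + 1)) *\<^sub>R P i X) *v U)))"
      by (rule summable_norm_bounded_linear [OF bl sum_P])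
    from suminf_dpow_exp [where c = c and A = "se3_hat X", OF c this [unfolded scale]]
    have "(\<Sum>n. (1 / fact n) *\<^sub>R dpow (se3_hat X) (c 0) n) =
        (\<Sum>i. se3_hat (((1 / fact (i + 1)) *\<^sub>R P i X) *v U)) ** matexp (se3_hat X)"
      by (simp only: scale)
    also have "(\<Sum>i. se3_hat (((1 / fact (i + 1)) *\<^sub>R P i X) *v U)) = se3_hat (dexp_series X *v U)"
      unfolding dexp_series_def
      by (rule bounded_linear.suminf [OF bl summable_norm_cancel [OF sum_P], symmetric])
    finally show ?thesis by (simp add: c_def P_def se3_exp_def)
  qed
  ultimately show ?thesis by simp
qed

text \<open>
  The matrix in the definition of \<^const>\<open>dexp\<close> is unique because \<open>se3_exp X\<close> is invertible and
  \<^const>\<open>se3_hat\<close> is injective.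
\<close>
lemma dexp_eq_series: "dexp X = dexp_series X"
  unfolding dexp_def
proof (rule the_equality)
  show "(se3_exp has_derivative (\<lambda>U. se3_hat (dexp_series X *v U) ** se3_exp X)) (at X)"
    by (rule has_derivative_se3_exp)
next
  fix D
  assume "(se3_exp has_derivative (\<lambda>U. se3_hat (D *v U) ** se3_exp X)) (at X)"
  from has_derivative_unique [OF this has_derivative_se3_exp]
  have eq: "se3_hat (D *v U) ** se3_exp X = se3_hat (dexp_series X *v U) ** se3_exp X" for U
    by metis
  have "se3_hat (D *v U) = se3_hat (dexp_series X *v U)" for U
    using arg_cong [OF eq [of U], of "\<lambda>M. M ** matexp (- se3_hat X)"]
    by (simp add: se3_exp_def matrix_mul_assoc [symmetric] matexp_mult_minus)
  then have "D *v U = dexp_series X *v U" for U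
    by (rule inj_se3_hat)
  then show "D = dexp_series X"
    by (simp add: matrix_eq)
qed

section \<open>The generating series of the Bernoulli numbers\<close>

text \<open>
  The defining recursion of the Bernoulli numbers says that \<open>\<Sum>n. B\<^sub>n / n! z\<^sup>n\<close> is the reciprocal of
  \<open>\<Sum>n. z\<^sup>n / (n + 1)! = (exp z - 1) / z\<close>.
\<close>

lemma sum_bernoulli_fact:
  "(\<Sum>i\<le>n. 1 / fact (i + 1) * (bernoulli (n - i) / fact (n - i))) = (if n = 0 then 1 else 0)"
proof (cases n)
  case (Suc m)
  have "(\<Sum>k\<le>n. bernoulli k / fact k / fact (n - k + 1)) = (\<Sum>k\<le>n. real ((n + 1) choose k) * bernoulli k) / fact (n + 1)"
    unfolding sum_divide_distrib
  proof (rule sum.cong)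
    fix k assume "k \<in> {..n}"
    then show "bernoulli k / fact k / fact (n - k + 1) = real ((n + 1) choose k) * bernoulli k / fact (n + 1)"
      using binomial_fact [of k "n + 1", where 'a = real] by (simp add: Suc_diff_le)
  qed simp
  also have "(\<Sum>k\<le>n. real ((n + 1) choose k) * bernoulli k) = 0"
    by (simp add: Suc del: binomial_Suc_Suc)
  finally show ?thesis
    using sum.nat_diff_reindex [of "\<lambda>i. 1 / fact (i + 1) * (bernoulli (n - i) / fact (n - i))" "Suc n"] Suc
    by (simp add: lessThan_Suc_atMost mult.commute)
qed simp

lemma exp_eq_1_imp_0:
  fixes z :: complex
  assumes "norm z < 2 * pi" "exp z = 1"
  shows "z = 0"
proof -
  from assms(2) obtain n :: int where n: "Re z = 0" "Im z = of_int (2 * n) * pi"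
    by (auto simp: exp_eq_1)
  have "\<bar>Im z\<bar> < 2 * pi" using assms(1) abs_Im_le_cmod [of z] by linarith
  then have "\<bar>real_of_int n\<bar> < 1" by (simp add: n abs_mult)
  then have "n = 0" by linarith
  with n show ?thesis by (simp add: complex_eq_iff)
qed

text \<open>
  The function \<open>(exp z - 1) / z\<close> has no zero in the disc of radius \<open>2 * pi\<close>; so its reciprocal is
  holomorphic there, and its Taylor series, whose coefficients are \<open>B\<^sub>n / n!\<close>, converges there.
\<close>
lemma summable_bernoulli:
  fixes x :: real
  assumes "\<bar>x\<bar> < 2 * pi"
  shows "summable (\<lambda>n. bernoulli n / fact n * x ^ n)"
proof -
  define F :: "complex fps" where "F = Abs_fps (\<lambda>n. 1 / fact (n + 1))"
  define G :: "complex fps" where "G = Abs_fps (\<lambda>n. of_real (bernoulli n / fact n))"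
  have F_sums: "(\<lambda>n. fps_nth F n * z ^ n) sums (if z = 0 then 1 else (exp z - 1) / z)" for z
  proof (cases "z = 0")
    case True
    then show ?thesis using powser_sums_zero [of "fps_nth F"] by (simp add: F_def)
  next
    case False
    have "(\<lambda>n. z ^ Suc n / fact (Suc n)) sums (exp z - 1)"
      using exp_converges [of z] by (subst sums_Suc_iff) (simp add: scaleR_conv_of_real field_simps)
    from sums_divide [OF this, of z] False show ?thesis by (simp add: F_def)
  qed
  have F_radius: "fps_conv_radius F = \<infinity>"
    unfolding fps_conv_radius_def by (rule conv_radius_inftyI'') (use F_sums in \<open>auto simp: sums_iff\<close>)
  have F_nonzero: "eval_fps F z \<noteq> 0" if "norm z < 2 * pi" for z
    using F_sums [of z] exp_eq_1_imp_0 [OF that] by (auto simp: eval_fps_def sums_iff split: if_splits)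
  have "F * G = 1"
  proof (rule fps_ext)
    fix n
    have "fps_nth (F * G) n =
        of_real (\<Sum>i\<le>n. 1 / fact (i + 1) * (bernoulli (n - i) / fact (n - i)))"
      by (simp add: fps_mult_nth F_def G_def atMost_atLeast0)
    then show "fps_nth (F * G) n = fps_nth 1 n"
      unfolding sum_bernoulli_fact by simp
  qed
  then have "inverse F = G" by (rule fps_inverse_unique)
  moreover have "(\<lambda>z. inverse (eval_fps F z)) has_fps_expansion inverse F"
    by (intro has_fps_expansion_inverse eval_fps_has_fps_expansion) (simp_all add: F_radius, simp add: F_def)
  moreover have "(\<lambda>z. inverse (eval_fps F z)) holomorphic_on eball 0 (2 * pi)"
    using F_nonzero by (intro holomorphic_on_inverse holomorphic_on_eval_fps) (auto simp: F_radius)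
  ultimately have "ereal (2 * pi) \<le> fps_conv_radius G"
    using holomorphic_on_imp_fps_conv_radius_ge by metis
  then have "summable (\<lambda>n. fps_nth G n * of_real x ^ n)"
    using assms by (intro summable_fps) (auto intro: less_le_trans [rotated])
  also have "(\<lambda>n. fps_nth G n * of_real x ^ n) = (\<lambda>n. of_real (bernoulli n / fact n * x ^ n))"
    by (simp add: G_def)
  finally show ?thesis by (simp only: summable_of_real_iff)
qed

section \<open>Second directional derivatives\<close>

text \<open>
  The second derivative differentiates the first one along a line through \<open>X\<close>, so the first one
  must be known on a neighbourhood \<open>T\<close> of \<open>X\<close>.
\<close>
lemma D2_from_has_derivative:
  fixes h :: "'a::real_normed_vector \<Rightarrow> 'b::real_normed_vector"
  assumes T: "open T" "X \<in> T"
    and h': "\<And>Y. Y \<in> T \<Longrightarrow> (h has_derivative h' Y) (at Y)"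
    and h'': "((\<lambda>Y. h' Y U) has_derivative h'') (at X)"
  shows "D2_exists h X U S" and "D2 h X U S = h'' S"
proof -
  have line: "((\<lambda>t. Y + t *\<^sub>R V) has_derivative (\<lambda>t. t *\<^sub>R V)) (at 0)" for Y V :: 'a
    by (auto intro!: derivative_eq_intros)
  have first: "((\<lambda>s. h (Y + s *\<^sub>R U)) has_vector_derivative h' Y U) (at 0)" if "Y \<in> T" for Y
    using has_derivative_compose [OF line [of Y U], of h "h' Y"] h' [OF that]
    by (simp add: has_vector_derivative_def linear_scale [OF has_derivative_linear [OF h' [OF that]]])
  define V where "V = (\<lambda>t. X + t *\<^sub>R S) -` T"
  have V: "open V" "0 \<in> V"
    unfolding V_def using T by (auto intro!: open_vimage continuous_intros)
  have second: "((\<lambda>t. h' (X + t *\<^sub>R S) U) has_vector_derivative h'' S) (at 0)"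
    using has_derivative_compose [OF line [of X S], of "\<lambda>Y. h' Y U" h''] h''
    by (simp add: has_vector_derivative_def linear_scale [OF has_derivative_linear [OF h'']])
  have D1: "D1 h Y U = h' Y U" if "Y \<in> T" for Y
    unfolding D1_def by (rule vector_derivative_at [OF first [OF that]])
  have D1_deriv: "((\<lambda>t. D1 h (X + t *\<^sub>R S) U) has_vector_derivative h'' S) (at 0)"
    by (rule has_vector_derivative_transform_within_open [OF second V])
      (simp add: D1 V_def)
  show "D2 h X U S = h'' S"
    unfolding D2_def by (rule vector_derivative_at [OF D1_deriv])
  show "D2_exists h X U S"
    unfolding D2_exists_def
  proof
    show "\<forall>\<^sub>F t in nhds 0. (\<lambda>s. h (X + t *\<^sub>R S + s *\<^sub>R U)) differentiable (at 0)"
      using eventually_nhds_in_open [OF V]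
      by eventually_elim (auto simp: V_def intro: differentiableI_vector [OF first])
    show "(\<lambda>t. D1 h (X + t *\<^sub>R S) U) differentiable (at 0)"
      by (rule differentiableI_vector [OF D1_deriv])
  qed
qed

text \<open>
  All functions in question have the form \<open>L (G (ad Y))\<close> with \<open>L\<close> linear and \<open>G\<close> a power or a power
  series: \<open>L\<close> is the identity for \<open>P i\<close>, and \<open>M \<mapsto> Q \<bullet> (M *v Z)\<close> for the Hessians.
\<close>

lemma has_derivative_linear_ad:
  assumes L: "bounded_linear L" and G: "(G has_derivative G') (at (ad X))"
  shows "((\<lambda>Y. L (G (ad Y))) has_derivative (\<lambda>U. L (G' (ad U)))) (at X)"
proof -
  have "(ad has_derivative ad) (at X)"
    by (rule bounded_linear_imp_has_derivative [OF bounded_linear_ad])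
  from diff_chain_at [OF this G] have "((\<lambda>Y. G (ad Y)) has_derivative (\<lambda>U. G' (ad U))) (at X)"
    unfolding o_def .
  from bounded_linear.has_derivative [OF L this] show ?thesis .
qed

lemma D2_linear_P:
  assumes "bounded_linear L"
  shows "D2_exists (\<lambda>Y. L (P i Y)) X U S"
    and "D2 (\<lambda>Y. L (P i Y)) X U S = L (d2pow (ad X) (ad U) (ad S) i)"
proof -
  have 1: "((\<lambda>Y. L (P i Y)) has_derivative (\<lambda>U. L (dpow (ad Y) (ad U) i))) (at Y)" for Y
    unfolding P_def using has_derivative_linear_ad [OF assms has_derivative_matpow] .
  have 2: "((\<lambda>Y. L (dpow (ad Y) (ad U) i)) has_derivative (\<lambda>S. L (d2pow (ad X) (ad U) (ad S) i))) (at X)"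
    using has_derivative_linear_ad [OF assms has_derivative_dpow] .
  note D2_from_has_derivative [OF open_UNIV UNIV_I, where h = "\<lambda>Y. L (P i Y)"
      and h' = "\<lambda>Y U. L (dpow (ad Y) (ad U) i)", OF 1 2]
  then show "D2_exists (\<lambda>Y. L (P i Y)) X U S"
    and "D2 (\<lambda>Y. L (P i Y)) X U S = L (d2pow (ad X) (ad U) (ad S) i)" by blast+
qed

lemma D2_linear_power_series:
  assumes "matrix_power_series N a R" and X: "N (ad X) < R" and L: "bounded_linear L"
    and h: "\<And>Y. N (ad Y) < R \<Longrightarrow> h Y = L (\<Sum>n. a n *\<^sub>R P n Y)"
  shows "D2_exists h X U S" (is ?E)
    and "D2 h X U S = L (\<Sum>n. a n *\<^sub>R d2pow (ad X) (ad U) (ad S) n)" (is ?D)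
proof -
  interpret matrix_power_series N a R by fact
  define T where "T = {Y. N (ad Y) < R}"
  have T: "open T" "X \<in> T"
    using open_vimage [OF open_ball linear_continuous_on [OF bounded_linear_ad], of R] X
    by (auto simp: T_def vimage_def)
  have 1: "(h has_derivative (\<lambda>U. L (\<Sum>n. a n *\<^sub>R dpow (ad Y) (ad U) n))) (at Y)" if "Y \<in> T" for Y
  proof (rule has_derivative_transform_within_open [OF _ T(1) that])
    show "((\<lambda>Y. L (\<Sum>n. a n *\<^sub>R P n Y)) has_derivative
        (\<lambda>U. L (\<Sum>n. a n *\<^sub>R dpow (ad Y) (ad U) n))) (at Y)"
      unfolding P_def
      using has_derivative_linear_ad [OF L has_derivative_power_series, of Y] that by (simp add: T_def)
  qed (simp add: h T_def)
  have 2: "((\<lambda>Y. L (\<Sum>n. a n *\<^sub>R dpow (ad Y) (ad U) n)) has_derivative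
      (\<lambda>S. L (\<Sum>n. a n *\<^sub>R d2pow (ad X) (ad U) (ad S) n))) (at X)"
    using has_derivative_linear_ad [OF L has_derivative_dpow_series [OF X, of "ad U"]] .
  note D2_from_has_derivative [OF T, where h = h
      and h' = "\<lambda>Y U. L (\<Sum>n. a n *\<^sub>R dpow (ad Y) (ad U) n)", OF 1 2]
  then show ?E ?D by blast+
qed

text \<open>
  The sum starts at degree two, since the terms of degree zero and one have no second derivative.
\<close>
lemma hessian_power_series:
  assumes ps: "matrix_power_series N a R" and X: "N (ad X) < R" and L: "bounded_linear L"
    and h: "\<And>Y. N (ad Y) < R \<Longrightarrow> h Y = L (\<Sum>n. a n *\<^sub>R P n Y)"
  shows "hessian_exists h X"
    and "(\<lambda>k. a (k + 2) *\<^sub>R hessian (\<lambda>Y. L (P (k + 2) Y)) X) sums hessian h X"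
proof -
  interpret matrix_power_series N a R by fact
  show "hessian_exists h X"
    unfolding hessian_exists_def using D2_linear_power_series(1) [OF ps X L] h by blast
  have "(\<lambda>k. (a (k + 2) *\<^sub>R hessian (\<lambda>Y. L (P (k + 2) Y)) X) $ i $ j) sums (hessian h X $ i $ j)" for i j
  proof -
    let ?U = "ad (axis j 1)" and ?S = "ad (axis i 1)"
    have "(\<lambda>n. L (a n *\<^sub>R d2pow (ad X) ?U ?S n)) sums L (\<Sum>n. a n *\<^sub>R d2pow (ad X) ?U ?S n)"
      using bounded_linear.sums [OF L summable_sums [OF summable_d2pow [OF X]]] .
    also have "L (\<Sum>n. a n *\<^sub>R d2pow (ad X) ?U ?S n) = hessian h X $ i $ j"
      using D2_linear_power_series(2) [OF ps X L, of h] h by (simp add: hessian_def)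
    also have "(\<lambda>n. L (a n *\<^sub>R d2pow (ad X) ?U ?S n)) =
        (\<lambda>n. (a n *\<^sub>R hessian (\<lambda>Y. L (P n Y)) X) $ i $ j)"
      by (simp add: hessian_def D2_linear_P(2) [OF L] linear_scale [OF bounded_linear.linear [OF L]])
    finally have "(\<lambda>n. (a n *\<^sub>R hessian (\<lambda>Y. L (P n Y)) X) $ i $ j) sums (hessian h X $ i $ j)" .
    moreover have "(a n *\<^sub>R hessian (\<lambda>Y. L (P n Y)) X) $ i $ j = 0" if "n < 2" for n
    proof -
      have "n = 0 \<or> n = 1" using that by auto
      then have "d2pow (ad X) ?U ?S n = 0" by auto
      then show ?thesis
        by (simp add: hessian_def D2_linear_P(2) [OF L] linear_0 [OF bounded_linear.linear [OF L]])
    qed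
    then have "(\<Sum>n<2. (a n *\<^sub>R hessian (\<lambda>Y. L (P n Y)) X) $ i $ j) = 0"
      by (intro sum.neutral) simp
    ultimately show ?thesis
      using sums_iff_shift [of "\<lambda>n. (a n *\<^sub>R hessian (\<lambda>Y. L (P n Y)) X) $ i $ j" 2]
      by (simp only: add_0_right)
  qed
  then show "(\<lambda>k. a (k + 2) *\<^sub>R hessian (\<lambda>Y. L (P (k + 2) Y)) X) sums hessian h X"
    unfolding sums_def by (intro vec_tendstoI) simp
qed

lemma bounded_linear_entry: "bounded_linear (\<lambda>M :: mat6. Q \<bullet> (M *v Z))"
  by (rule bounded_linear_compose [OF bounded_linear_inner_right matrix_vector.bounded_linear_left])

section \<open>The second derivative and the Hessian of the powers\<close>

text \<open>
  By \<open>ad S *v V = - (ad V *v S)\<close> the direction \<open>S\<close> can be moved to the end of every word.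
\<close>

lemma dpow_ad_mult_vec:
  "dpow (ad X) (ad S) j *v W = (\<Sum>l<j. P2 j l X W *v S)"
proof -
  have "(matpow (ad X) l ** ad S ** matpow (ad X) (j - Suc l)) *v W = P2 j l X W *v S" for l
    using ad_antisym [of S]
    by (simp add: P2_def P_def matrix_vector_mul_assoc [symmetric] matrix_vector.minus_left matrix_vector.minus_right)
  then show ?thesis by (simp add: dpow_eq_sum matrix_vector.sum_left)
qed

lemma atLeastAtMost_pred: "Suc 0 \<le> j \<Longrightarrow> {0..j - Suc 0} = {..<j}"
  by auto

lemma sum_pos_less:
  fixes f :: "nat \<Rightarrow> 'a::comm_monoid_add"
  assumes "f 0 = 0"
  shows "(\<Sum>j<n. f j) = (\<Sum>j=1..n - 1. f j)"
  by (rule sum.mono_neutral_cong_right) (use assms in \<open>auto simp: not_le intro: Suc_leI\<close>)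

text \<open>
  Each of the two orders of the marked letters is summed over the position of \<open>U\<close>, while the part
  that contains \<open>S\<close> is collected into a first derivative of a power. The outer sum leaves out
  \<open>j = 0\<close>, where this first derivative vanishes.
\<close>
lemma D2_P:
  "D2 (P i) X U S *v Z =
     (\<Sum>j = 1..i - 1. \<Sum>l = 0..j - 1.
        P2 j l X (ad U *v (P (i - j - 1) X *v Z)) *v S +
        P (i - j - 1) X *v (ad U *v (P2 j l X Z *v S)))"
proof -
  let ?A = "ad X" and ?U = "ad U" and ?S = "ad S"
  have "D2 (P i) X U S = d2pow ?A ?U ?S i"
    using D2_linear_P(2) [OF bounded_linear_ident] .
  also have "\<dots> = (\<Sum>j<i. matpow ?A (i - Suc j) ** ?U ** dpow ?A ?S j) +
      (\<Sum>j<i. dpow ?A ?S j ** ?U ** matpow ?A (i - Suc j))"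
    by (simp add: d2pow_eq_sum [of ?A ?U ?S] sum_words_regroup)
  finally have "D2 (P i) X U S *v Z =
      (\<Sum>j<i. dpow ?A ?S j *v (?U *v (matpow ?A (i - Suc j) *v Z)) +
        matpow ?A (i - Suc j) *v (?U *v (dpow ?A ?S j *v Z)))"
    by (simp add: matrix_vector.add_left matrix_vector.sum_left matrix_vector_mul_assoc matrix_mul_assoc
        sum.distrib add.commute)
  also have "\<dots> = (\<Sum>j=1..i - 1. dpow ?A ?S j *v (?U *v (matpow ?A (i - Suc j) *v Z)) +
        matpow ?A (i - Suc j) *v (?U *v (dpow ?A ?S j *v Z)))"
    by (rule sum_pos_less) simp
  also have "\<dots> = (\<Sum>j = 1..i - 1. \<Sum>l = 0..j - 1.
        P2 j l X (ad U *v (P (i - j - 1) X *v Z)) *v S +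
        P (i - j - 1) X *v (ad U *v (P2 j l X Z *v S)))"
    by (intro sum.cong refl)
      (simp add: atLeastAtMost_pred dpow_ad_mult_vec P_def sum.distrib matrix_vector.sum_right)
  finally show ?thesis .
qed

lemma inner_transpose: "(transpose M *v Q) \<bullet> V = Q \<bullet> (M *v V)" for M :: "real ^ 'n::finite ^ 'm::finite"
  by (simp add: dot_lmul_matrix)

text \<open>
  The antisymmetry of \<open>ad\<close> exchanges \<open>U\<close> and \<open>W\<close>, and then \<open>transpose (ad W) *v V = ad_bar V *v W\<close>
  applies.
\<close>
lemma inner_ad_bar: "U \<bullet> (ad_bar V *v W) = - (V \<bullet> (ad U *v W))"
proof -
  have "V \<bullet> (ad U *v W) = - (V \<bullet> (ad W *v U))" by (subst ad_antisym) simp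
  also have "V \<bullet> (ad W *v U) = (transpose (ad W) *v V) \<bullet> U"
    by (rule inner_transpose [symmetric])
  also have "\<dots> = U \<bullet> (ad_bar V *v W)"
    by (simp only: ad_transpose_mult_vec inner_commute)
  finally show ?thesis by simp
qed

lemma H_bar_eq:
  "H_bar i Q Z X = - (\<Sum>j = 1..i - 1. \<Sum>l = 0..j - 1.
     ad_bar (transpose (P (i - j - 1) X) *v Q) ** P2 j l X Z)"
  by (simp add: H_bar_def P2_def matrix_mul_assoc matrix_mult.minus_right sum_negf)

text \<open>
  As a bilinear form in \<open>U\<close> and \<open>S\<close>, \<^const>\<open>H_bar\<close> is the part of the second derivative in which
  \<open>U\<close> stands to the left of \<open>S\<close>. Exchanging \<open>U\<close> and \<open>S\<close> gives the other part, which is why the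
  Hessian is \<^const>\<open>H_bar\<close> plus its transpose.
\<close>
lemma inner_H_bar:
  "U \<bullet> (H_bar i Q Z X *v S) =
     Q \<bullet> ((\<Sum>j<i. matpow (ad X) (i - Suc j) ** ad U ** dpow (ad X) (ad S) j) *v Z)"
proof -
  have word: "- (U \<bullet> (ad_bar (transpose (P m X) *v Q) *v (dpow (ad X) (ad S) j *v Z))) =
      Q \<bullet> ((matpow (ad X) m ** ad U ** dpow (ad X) (ad S) j) *v Z)" for m j
    unfolding inner_ad_bar inner_transpose P_def
    by (simp add: matrix_vector_mul_assoc matrix_mul_assoc)
  have "U \<bullet> (H_bar i Q Z X *v S) =
      (\<Sum>j=1..i - 1. - (U \<bullet> (ad_bar (transpose (P (i - Suc j) X) *v Q) *v (dpow (ad X) (ad S) j *v Z))))"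
    unfolding H_bar_eq
    by (simp add: atLeastAtMost_pred dpow_ad_mult_vec matrix_vector.minus_left matrix_vector.sum_left matrix_vector.sum_right
        inner_sum_right sum_negf matrix_vector_mul_assoc del: transpose_matrix_vector cong: sum.cong_simp)
  also have "\<dots> = (\<Sum>j<i. Q \<bullet> ((matpow (ad X) (i - Suc j) ** ad U ** dpow (ad X) (ad S) j) *v Z))"
    unfolding word by (rule sum_pos_less [symmetric]) simp
  finally show ?thesis by (simp add: matrix_vector.sum_left inner_sum_right)
qed

lemma hessian_P:
  "hessian (\<lambda>Y. Q \<bullet> (P i Y *v Z)) X = H_bar i Q Z X + transpose (H_bar i Q Z X)"
proof -
  have entry: "M $ a $ b = axis a 1 \<bullet> (M *v axis b 1)" for M :: mat6 and a b
    by (simp add: inner_axis' matrix_vector_mult_basis column_def)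
  have "hessian (\<lambda>Y. Q \<bullet> (P i Y *v Z)) X $ a $ b = H_bar i Q Z X $ a $ b + H_bar i Q Z X $ b $ a" for a b
    unfolding entry [of "H_bar i Q Z X"] inner_H_bar
    by (simp add: hessian_def D2_linear_P(2) [OF bounded_linear_entry] d2pow_eq_sum
        matrix_vector.add_left inner_add_right)
  then show ?thesis by (simp add: vec_eq_iff transpose_def)
qed

section \<open>The inverse of the differential\<close>

lemma matrix_inv_eqI:
  fixes A B :: "real ^ 'n::finite ^ 'n"
  assumes "A ** B = mat 1"
  shows "matrix_inv A = B"
  unfolding matrix_inv_def
proof (rule some_equality)
  show "A ** B = mat 1 \<and> B ** A = mat 1"
    using assms matrix_left_right_inverse by blast
next
  fix C
  assume "A ** C = mat 1 \<and> C ** A = mat 1"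
  then show "C = B"
    using assms by (metis matrix_mul_assoc matrix_mul_lid matrix_mul_rid)
qed

lemma dexp_inverse:
  assumes "matrix_power_series N (\<lambda>n. bernoulli n / fact n) R" and "N (ad Y) < R"
  shows "matrix_inv (dexp Y) = (\<Sum>n. (bernoulli n / fact n) *\<^sub>R P n Y)"
proof -
  interpret matrix_power_series N "\<lambda>n. bernoulli n / fact n" R by fact
  have "dexp Y ** (\<Sum>n. (bernoulli n / fact n) *\<^sub>R P n Y) = mat 1"
    unfolding dexp_eq_series dexp_series_def P_def
    using sum_bernoulli_fact
    by (intro matrix_power_series_inverse summable_norm_matrix_power_series_exp dexp_coeff_bound
        summable_norm_powers assms(2))
  then show ?thesis by (rule matrix_inv_eqI)
qed

section \<open>A norm adapted to the angular part\<close>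

text \<open>
  The automorphism \<open>(x, y) \<mapsto> (x, e y)\<close> of the Lie algebra se(3). For small \<open>e\<close>,
  conjugation by it shrinks the linear part in \<open>ad X\<close>.
\<close>

definition stretch :: "real \<Rightarrow> mat6" where
  "stretch e = (\<chi> i j. if i = j then (case i of Inl _ \<Rightarrow> 1 | Inr _ \<Rightarrow> e) else 0)"

lemma ang_stretch [simp]: "ang (stretch e *v V) = ang V"
  and lin_stretch [simp]: "lin (stretch e *v V) = e *\<^sub>R lin V"
  by (simp_all add: ang_def lin_def stretch_def matrix_vector_mult_def sum_UNIV_plus vec_eq_iff
      if_distrib [of "\<lambda>x. x * _"] cong: if_cong)

lemma stretch_inverse: "e \<noteq> 0 \<Longrightarrow> stretch (1 / e) ** stretch e = mat 1"
  by (simp add: matrix_eq vec6_eq_iff flip: matrix_vector_mul_assoc)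

lemma stretch_conj_ad:
  assumes "e \<noteq> 0"
  shows "stretch e ** ad X ** stretch (1 / e) = ad (stretch e *v X)"
  using assms
  by (simp add: matrix_eq vec6_eq_iff cross_mult_left cross_mult_right scaleR_add_right
      flip: matrix_vector_mul_assoc)

lemma norm_vec6: "norm X = sqrt ((norm (ang X))\<^sup>2 + (norm (lin X))\<^sup>2)"
proof -
  have "(norm X)\<^sup>2 = (norm (ang X))\<^sup>2 + (norm (lin X))\<^sup>2"
    by (simp add: power2_norm_eq_inner inner_vec_def sum_UNIV_plus ang_def lin_def)
  then show ?thesis by (metis norm_ge_zero real_sqrt_unique)
qed

lemma norm_cross_le: "norm (cross3 x y) \<le> norm x * norm y"
proof (rule power2_le_imp_le)
  show "(norm (cross3 x y))\<^sup>2 \<le> (norm x * norm y)\<^sup>2"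
    using norm_cross_dot [of x y] zero_le_power2 [of "x \<bullet> y"] by linarith
qed simp

lemma onorm_ad_le: "onorm ((*v) (ad X)) \<le> norm (ang X) + norm (lin X)"
proof (rule onorm_le)
  fix V
  let ?x = "norm (ang X)" and ?y = "norm (lin X)" and ?v = "norm (ang V)" and ?w = "norm (lin V)"
  have "norm (ad X *v V) \<le> sqrt ((?x * ?v + 0)\<^sup>2 + (?x * ?w + ?y * ?v)\<^sup>2)"
    unfolding norm_vec6 [of "ad X *v V"] ang_ad lin_ad
    using norm_cross_le [of "ang X" "ang V"] norm_cross_le [of "ang X" "lin V"]
      norm_cross_le [of "lin X" "ang V"]
      norm_triangle_ineq [of "cross3 (lin X) (ang V)" "cross3 (ang X) (lin V)"]
    by (intro real_sqrt_le_mono add_mono power_mono) auto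
  \<comment> \<open>the pair of norms is a contribution of the angular part of \<open>X\<close> plus one of its linear part\<close>
  also have "\<dots> \<le> sqrt ((?x * ?v)\<^sup>2 + (?x * ?w)\<^sup>2) + sqrt (0\<^sup>2 + (?y * ?v)\<^sup>2)"
    by (rule real_sqrt_sum_squares_triangle_ineq)
  also have "sqrt ((?x * ?v)\<^sup>2 + (?x * ?w)\<^sup>2) = ?x * norm V"
    by (simp add: norm_vec6 [of V] power_mult_distrib real_sqrt_mult flip: distrib_left)
  also have "sqrt (0\<^sup>2 + (?y * ?v)\<^sup>2) \<le> ?y * norm V"
    by (simp add: norm_vec6 [of V] mult_left_mono real_le_rsqrt)
  finally show "norm (ad X *v V) \<le> (norm (ang X) + norm (lin X)) * norm V"
    by (simp add: distrib_right)
qed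

text \<open>
  The spectral radius of \<open>ad X\<close> is the norm of the angular part. In the standard norm the linear
  part contributes as well; after a stretch by a small \<open>e\<close> its contribution fits into the gap
  between the angular part and \<open>r\<close>.
\<close>
lemma obtain_norm_ad_less:
  assumes "norm (ang X) < r"
  obtains N where "matrix_algebra_norm N" and "N (ad X) < r"
proof -
  define e where "e = (r - norm (ang X)) / (norm (lin X) + 1)"
  have e: "0 < e" "e * norm (lin X) < r - norm (ang X)"
  proof -
    show "0 < e" using assms by (simp add: e_def add_nonneg_pos)
    moreover have "e * (norm (lin X) + 1) = r - norm (ang X)"
      using norm_ge_zero [of "lin X"] by (simp add: e_def del: norm_ge_zero)
    ultimately show "e * norm (lin X) < r - norm (ang X)" by (simp add: distrib_left)
  qed
  show thesis
  proof (rule that [of "conj_norm (stretch e) (stretch (1 / e))"])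
    show "matrix_algebra_norm (conj_norm (stretch e) (stretch (1 / e)))"
      using e by (intro matrix_algebra_norm_conj_norm stretch_inverse) simp
    have "conj_norm (stretch e) (stretch (1 / e)) (ad X) \<le> norm (ang X) + e * norm (lin X)"
      using onorm_ad_le [of "stretch e *v X"] e(1) by (simp add: conj_norm_def stretch_conj_ad)
    then show "conj_norm (stretch e) (stretch (1 / e)) (ad X) < r" using e(2) by simp
  qed
qed

section \<open>Hessians of the differential and of its inverse\<close>

theorem lemma8:
  fixes X U S Q Z :: "real ^ (3 + 3)"
  shows
    "(\<forall>i\<ge>2. D2_exists (P i) X U S \<and>
        D2 (P i) X U S *v Z =
          (\<Sum>j = 1..i - 1. \<Sum>l = 0..j - 1.
             P2 j l X (ad U *v (P (i - j - 1) X *v Z)) *v S +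
             P (i - j - 1) X *v (ad U *v (P2 j l X Z *v S)))) \<and>
     (hessian_exists (\<lambda>Y. Q \<bullet> (dexp Y *v Z)) X \<and>
        (\<lambda>k. (1 / fact (k + 2 + 1)) *\<^sub>R hessian (\<lambda>Y. Q \<bullet> (P (k + 2) Y *v Z)) X)
          sums hessian (\<lambda>Y. Q \<bullet> (dexp Y *v Z)) X) \<and>
     (norm (ang X) < 2 * pi \<longrightarrow>
        hessian_exists (\<lambda>Y. Q \<bullet> (matrix_inv (dexp Y) *v Z)) X \<and>
        (\<lambda>k. (bernoulli (k + 2) / fact (k + 2)) *\<^sub>R hessian (\<lambda>Y. Q \<bullet> (P (k + 2) Y *v Z)) X)
          sums hessian (\<lambda>Y. Q \<bullet> (matrix_inv (dexp Y) *v Z)) X) \<and>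
     (\<forall>i\<ge>2. hessian_exists (\<lambda>Y. Q \<bullet> (P i Y *v Z)) X \<and>
        hessian (\<lambda>Y. Q \<bullet> (P i Y *v Z)) X = H_bar i Q Z X + transpose (H_bar i Q Z X) \<and>
        H_bar i Q Z X =
          - (\<Sum>j = 1..i - 1. \<Sum>l = 0..j - 1.
               ad_bar (transpose (P (i - j - 1) X) *v Q) ** P2 j l X Z))"
    (is "?derivatives \<and> ?dexp \<and> (_ \<longrightarrow> ?dexp_inv) \<and> ?hessians")
proof (intro conjI impI)
  show ?derivatives
    using D2_linear_P(1) [OF bounded_linear_ident] D2_P by blast
  show ?hessians
    using D2_linear_P(1) [OF bounded_linear_entry] hessian_P H_bar_eq
    unfolding hessian_exists_def by blast
  have ps: "matrix_power_series (conj_norm (mat 1) (mat 1)) (\<lambda>n. 1 / fact (n + 1)) R" for R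
    by (rule matrix_power_series_exp [OF dexp_coeff_bound])
  show "hessian_exists (\<lambda>Y. Q \<bullet> (dexp Y *v Z)) X"
    and "(\<lambda>k. (1 / fact (k + 2 + 1)) *\<^sub>R hessian (\<lambda>Y. Q \<bullet> (P (k + 2) Y *v Z)) X)
          sums hessian (\<lambda>Y. Q \<bullet> (dexp Y *v Z)) X"
    using hessian_power_series [OF ps _ bounded_linear_entry, of X "conj_norm (mat 1) (mat 1) (ad X) + 1"
        "\<lambda>Y. Q \<bullet> (dexp Y *v Z)" Q Z]
    by (simp_all add: dexp_eq_series dexp_series_def)
  assume "norm (ang X) < 2 * pi"
  then obtain N where N: "matrix_algebra_norm N" "N (ad X) < 2 * pi"
    by (rule obtain_norm_ad_less)
  then interpret matrix_algebra_norm N by simp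
  have ps: "matrix_power_series N (\<lambda>n. bernoulli n / fact n) (2 * pi)"
    by unfold_locales (rule summable_bernoulli)
  show "hessian_exists (\<lambda>Y. Q \<bullet> (matrix_inv (dexp Y) *v Z)) X"
    and "(\<lambda>k. (bernoulli (k + 2) / fact (k + 2)) *\<^sub>R hessian (\<lambda>Y. Q \<bullet> (P (k + 2) Y *v Z)) X)
          sums hessian (\<lambda>Y. Q \<bullet> (matrix_inv (dexp Y) *v Z)) X"
    using hessian_power_series [OF ps N(2) bounded_linear_entry, of "\<lambda>Y. Q \<bullet> (matrix_inv (dexp Y) *v Z)" Q Z]
    by (simp_all add: dexp_inverse [OF ps])
qed

end
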